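(* Let $X$ be a complex Hilbert space, and let $Y$ be a complex Banach space. Let $T \in \mathcal{L}(X)$ be power-bounded, and let $S \in \mathcal{L}(Y,X)$. Suppose that $\alpha > 0$ and $k \in \mathbb{N}$ satisfy $k > \alpha + 1/2$. If $f \colon (0,\infty) \to (0,\infty)$ is $\alpha$-bounded regularly varying, then the following statements are equivalent: (i) $\|T^nS\| = O(1/f(n))$ as $n \to \infty$. (ii) There exists a constant $M>0$ such that $$\sup_{1<r<2} F_k(r^2-1) \int_{0}^{2\pi} \|R(r e^{i \theta}, T)^k S y\|^2 \, d\theta \leq M \|y\|^2$$ for all $y \in Y$, where $F_k(s) := s^{2k-1} f(1/s)^{2}$ for $s>0$.
   Context: $\mathcal{L}(Y,X)$ denotes the space of bounded linear operators from $Y$ to $X$, and $\mathcal{L}(X)=\mathcal{L}(X,X)$. An operator $T \in \mathcal{L}(X)$ is power-bounded if $\sup_{n \ge 0}\|T^n\| < \infty$ (then its spectral radius is at most $1$). For $\lambda$ in the resolvent set of $T$, $R(\lambda,T) = (\lambda I - T)^{-1}$. $\mathbb{N}$ is the set of positive integers. For $\alpha \ge 0$, a function $f \colon (0,\infty) \to (0,\infty)$ is called $\alpha$-bounded regularly varying if there exists $t_0>0$ such that $f$ is non-decreasing on $[t_0,\infty)$, is absolutely continuous on each compact subinterval of $[t_0,\infty)$, and satisfies $t f'(t)/f(t) \le \alpha$ for a.e. $t \ge t_0$. $a(n) = O(b(n))$ as $n\to\infty$ means there are constants $K>0$, $n_0$ with $a(n)\le K b(n)$ for all $n \ge n_0$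.
   Formalization: It is additionally assumed that f is bounded above on (1/3, b] for every b; without this the implication (i) ⇒ (ii) fails, e.g. for X = Y = ℂ, T = 0, S = I, α = 1, k = 2 and f(t) = 1/|t−1| for t < 2, t ≠ 1, f = 1 otherwise. *)

theory Defs
  imports "HOL-Analysis.Analysis" "HOL-Library.Landau_Symbols"
begin

text \<open>Complex Banach spaces are the types of sort
  \<open>{complex_normed_vector, complete_space}\<close>, complex Hilbert spaces those of sort
  \<open>{complex_inner, complete_space}\<close>.\<close>

class complex_normed_vector = real_normed_vector +
  fixes scaleC :: "complex \<Rightarrow> 'a \<Rightarrow> 'a"  (infixr "*\<^sub>C" 75)
  assumes scaleC_add_right: "c *\<^sub>C (x + y) = c *\<^sub>C x + c *\<^sub>C y"
    and scaleC_add_left: "(c + d) *\<^sub>C x = c *\<^sub>C x + d *\<^sub>C x"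
    and scaleC_scaleC: "c *\<^sub>C (d *\<^sub>C x) = (c * d) *\<^sub>C x"
    and scaleC_of_real: "complex_of_real r *\<^sub>C x = r *\<^sub>R x"
    and norm_scaleC: "norm (c *\<^sub>C x) = cmod c * norm x"

class complex_inner = complex_normed_vector +
  fixes cinner :: "'a \<Rightarrow> 'a \<Rightarrow> complex"
  assumes cinner_commute: "cinner x y = cnj (cinner y x)"
    and cinner_add_left: "cinner (x + y) z = cinner x z + cinner y z"
    and cinner_scaleC_left: "cinner (c *\<^sub>C x) y = c * cinner x y"
    and cinner_self: "cinner x x = complex_of_real ((norm x)\<^sup>2)"

instantiation complex :: complex_inner
begin

definition scaleC_complex :: "complex \<Rightarrow> complex \<Rightarrow> complex"
  where "scaleC_complex c x = c * x"

definition cinner_complex :: "complex \<Rightarrow> complex \<Rightarrow> complex"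
  where "cinner_complex x y = x * cnj y"

instance
proof
  fix x y z c d :: complex and r :: real
  show "c *\<^sub>C (x + y) = c *\<^sub>C x + c *\<^sub>C y" "(c + d) *\<^sub>C x = c *\<^sub>C x + d *\<^sub>C x"
    "c *\<^sub>C (d *\<^sub>C x) = (c * d) *\<^sub>C x"
    by (simp_all add: scaleC_complex_def distrib_left distrib_right mult.assoc)
  show "complex_of_real r *\<^sub>C x = r *\<^sub>R x" "norm (c *\<^sub>C x) = cmod c * norm x"
    by (simp_all add: scaleC_complex_def scaleR_conv_of_real norm_mult)
  show "cinner x y = cnj (cinner y x)" "cinner (x + y) z = cinner x z + cinner y z"
    "cinner (c *\<^sub>C x) y = c * cinner x y"
    by (simp_all add: cinner_complex_def scaleC_complex_def distrib_left distrib_right mult.assoc mult.commute)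
  show "cinner x x = complex_of_real ((norm x)\<^sup>2)"
    by (simp only: cinner_complex_def complex_norm_square)
qed

end

definition bounded_clinear ::
    "('a::complex_normed_vector \<Rightarrow> 'b::complex_normed_vector) \<Rightarrow> bool"
  where "bounded_clinear A \<longleftrightarrow> bounded_linear A \<and> (\<forall>c x. A (c *\<^sub>C x) = c *\<^sub>C A x)"

definition power_bounded :: "('a::complex_normed_vector \<Rightarrow> 'a) \<Rightarrow> bool"
  where "power_bounded T \<longleftrightarrow> bdd_above (range (\<lambda>n::nat. onorm (T ^^ n)))"

text \<open>Only meaningful for \<open>\<mu>\<close> in the resolvent set of \<open>T\<close>.  For power-bounded \<open>T\<close> on a
  Banach space this includes every \<open>\<mu>\<close> with \<open>cmod \<mu> > 1\<close>.\<close>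

definition resolvent :: "complex \<Rightarrow> ('a::complex_normed_vector \<Rightarrow> 'a) \<Rightarrow> 'a \<Rightarrow> 'a"
  where "resolvent \<mu> T = inv (\<lambda>x. \<mu> *\<^sub>C x - T x)"

definition abs_continuous_on_interval :: "real \<Rightarrow> real \<Rightarrow> (real \<Rightarrow> real) \<Rightarrow> bool"
  where "abs_continuous_on_interval a b f \<longleftrightarrow>
    (\<forall>\<epsilon>>0. \<exists>\<delta>>0. \<forall>P. finite P \<longrightarrow>
       (\<forall>(c, d)\<in>P. a \<le> c \<and> c < d \<and> d \<le> b) \<longrightarrow>
       pairwise (\<lambda>(c, d) (c', d'). {c<..<d} \<inter> {c'<..<d'} = {}) P \<longrightarrow>
       (\<Sum>(c, d)\<in>P. d - c) < \<delta> \<longrightarrow>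
       (\<Sum>(c, d)\<in>P. \<bar>f d - f c\<bar>) < \<epsilon>)"

text \<open>Functions on \<open>(0,\<infinity>)\<close> are represented by total functions on the reals whose values
  at nonpositive arguments are irrelevant.\<close>

definition bounded_regularly_varying :: "real \<Rightarrow> (real \<Rightarrow> real) \<Rightarrow> bool"
  where "bounded_regularly_varying \<alpha> f \<longleftrightarrow>
    (\<forall>t>0. f t > 0) \<and>
    (\<exists>t\<^sub>0>0. mono_on {t\<^sub>0..} f \<and>
       (\<forall>a b. t\<^sub>0 \<le> a \<longrightarrow> a \<le> b \<longrightarrow> abs_continuous_on_interval a b f) \<and>
       (AE t in lebesgue. t \<ge> t\<^sub>0 \<longrightarrow>
          (\<exists>f'. (f has_real_derivative f') (at t) \<and> t * f' / f t \<le> \<alpha>)))"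

definition F_weight :: "(real \<Rightarrow> real) \<Rightarrow> nat \<Rightarrow> real \<Rightarrow> real"
  where "F_weight f k s = s ^ (2 * k - 1) * (f (1 / s))\<^sup>2"

end

theory Submission
  imports Defs
begin

text \<open>The Neumann series gives \<open>R(\<mu>,T)^k x = \<Sum>n. (n+k-1 choose n) \<mu>^-(n+k) T^n x\<close>, so by
  Parseval's identity the integral in (ii) equals
  \<open>2\<pi> \<Sum>n. (n+k-1 choose n)^2 r^(-2(n+k)) \<parallel>T^n S y\<parallel>^2\<close>, a weighted sum with weights of order
  \<open>n^(2k-2)\<close> effectively cut off at \<open>n \<approx> 1/s\<close>, where \<open>s = r^2 - 1\<close>.

  If \<open>\<parallel>T^n S\<parallel> = O(1/f(n))\<close>, then, since \<open>f(t)/t^\<alpha>\<close> is eventually decreasing,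
  \<open>f(1/s) / f(n)\<close> is bounded by a multiple of \<open>1 + (s(n+1))^-\<alpha>\<close>, and \<open>2k - 2 - 2\<alpha> > -1\<close> makes the
  weighted sum \<open>O(s^-(2k-1))\<close>.  Conversely, for \<open>r^2 = 1 + 1/N\<close> power-boundedness lets one replace
  \<open>\<parallel>T^n S y\<parallel>\<close> by a multiple of \<open>\<parallel>T^N S y\<parallel>\<close> in the terms \<open>n \<le> N\<close>, whose weights add up to at least
  a multiple of \<open>N^(2k-1)\<close>.\<close>

section \<open>Parseval's identity\<close>

lemma bounded_linear_scaleC:
  "bounded_linear (\<lambda>x::'a::complex_normed_vector. c *\<^sub>C x)"
proof (rule bounded_linear_intro[where K = "cmod c"])
  show "c *\<^sub>C (r *\<^sub>R x) = r *\<^sub>R (c *\<^sub>C x)" for r and x :: 'a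
    by (metis scaleC_of_real scaleC_scaleC mult.commute)
qed (simp_all add: scaleC_add_right norm_scaleC mult.commute)

lemma scaleC_zero_left [simp]: "0 *\<^sub>C (x::'a::complex_normed_vector) = 0"
  using norm_scaleC[of 0 x] by simp

lemma scaleC_one [simp]: "1 *\<^sub>C (x::'a::complex_normed_vector) = x"
  using scaleC_of_real[of 1 x] by simp

lemma scaleC_diff_left:
  "(c - d) *\<^sub>C (x::'a::complex_normed_vector) = c *\<^sub>C x - d *\<^sub>C x"
  using scaleC_add_left[of "c - d" d x] by simp

lemma cinner_add_right:
  "cinner (x::'a::complex_inner) (y + z) = cinner x y + cinner x z"
  by (metis cinner_add_left cinner_commute complex_cnj_add)

lemma cinner_scaleC_right:
  "cinner (x::'a::complex_inner) (c *\<^sub>C y) = cnj c * cinner x y"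
  by (metis cinner_commute cinner_scaleC_left complex_cnj_mult)

lemma cinner_sum_left:
  "cinner (sum g A) (y::'a::complex_inner) = (\<Sum>i\<in>A. cinner (g i) y)"
proof -
  have "cinner 0 y = 0"
    using cinner_add_left[of 0 0 y] by simp
  then show ?thesis
    by (induction A rule: infinite_finite_induct) (simp_all add: cinner_add_left)
qed

lemma cinner_sum_right:
  "cinner (x::'a::complex_inner) (sum g A) = (\<Sum>i\<in>A. cinner x (g i))"
proof -
  have "cinner x 0 = 0"
    using cinner_add_right[of x 0 0] by simp
  then show ?thesis
    by (induction A rule: infinite_finite_induct) (simp_all add: cinner_add_right)
qed

text \<open>Absolute convergence for the sort in which \<open>X\<close> lives: the triangle
  inequality bounds blocks of \<open>g\<close> by blocks of the norms, so the partial sums are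
  Cauchy.\<close>

lemma summable_norm_complete:
  fixes g :: "nat \<Rightarrow> 'a::{real_normed_vector, complete_space}"
  assumes "summable (\<lambda>n. norm (g n))"
  shows "summable g"
proof -
  have "Cauchy (\<lambda>n. \<Sum>i<n. g i)"
  proof (rule CauchyI')
    fix e :: real
    assume "e > 0"
    then obtain N where N: "\<And>m n. m \<ge> N \<Longrightarrow> norm (\<Sum>i=m..<n. norm (g i)) < e"
      using assms unfolding summable_Cauchy by blast
    have "norm ((\<Sum>i<m. g i) - (\<Sum>i<n. g i)) < e" if "m \<ge> N" "n > m" for m n
    proof -
      have "(\<Sum>i<n. g i) - (\<Sum>i<m. g i) = (\<Sum>i=m..<n. g i)"
        using sum_diff_nat_ivl[of 0 m n g] \<open>n > m\<close> by (simp add: atLeast0LessThan)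
      then have "norm ((\<Sum>i<m. g i) - (\<Sum>i<n. g i)) \<le> (\<Sum>i=m..<n. norm (g i))"
        by (metis norm_minus_commute norm_sum)
      then show ?thesis
        using N[OF \<open>m \<ge> N\<close>, of n] by simp
    qed
    then show "\<exists>M. \<forall>m\<ge>M. \<forall>n>m. dist (\<Sum>i<m. g i) (\<Sum>i<n. g i) < e"
      unfolding dist_norm by blast
  qed
  then show ?thesis
    by (simp add: Cauchy_convergent summable_iff_convergent)
qed

text \<open>Orthogonality of the characters. For distinct indices the integrand is
  \<open>cis (d * \<theta>)\<close> with \<open>d\<close> a nonzero integer, and its primitive takes
  the same value at 0 and 2 pi.\<close>

lemma has_integral_cis_diff:
  "((\<lambda>\<theta>. cis (- (real m * \<theta>)) * cnj (cis (- (real n * \<theta>)))) has_integral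
     (if m = n then 2 * pi else 0)) {0..2 * pi}"
proof (cases "m = n")
  case True
  then show ?thesis
    using has_integral_const_real[of "1::complex" 0 "2 * pi"]
    by (simp add: cis_cnj cis_mult scaleR_conv_of_real)
next
  case False
  define d where "d = real n - real m"
  have "d \<noteq> 0"
    using False by (simp add: d_def)
  have der: "((\<lambda>\<theta>. exp (\<i> * of_real (d * \<theta>)) / (\<i> * d)) has_vector_derivative
      exp (\<i> * of_real (d * x))) (at x within {0..2 * pi})" for x
    unfolding of_real_mult
    by (rule has_vector_derivative_real_field, (rule derivative_eq_intros refl | simp add: \<open>d \<noteq> 0\<close>)+)
      (simp add: mult.left_commute[of \<i>])
  have "((\<lambda>\<theta>. exp (\<i> * of_real (d * \<theta>))) has_integral
      exp (\<i> * of_real (d * (2 * pi))) / (\<i> * d) - exp (\<i> * of_real (d * 0)) / (\<i> * d)) {0..2 * pi}"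
    by (rule fundamental_theorem_of_calculus) (use der in auto)
  moreover have "exp (\<i> * of_real (d * (2 * pi))) = 1"
  proof -
    have "cis (d * (2 * pi)) = cis (2 * pi * (of_int (int n - int m)))"
      by (simp add: d_def mult_ac)
    also have "\<dots> = 1"
      by (rule cis_multiple_2pi) simp
    finally show ?thesis
      by (simp add: cis_conv_exp)
  qed
  ultimately have "((\<lambda>\<theta>. cis (d * \<theta>)) has_integral 0) {0..2 * pi}"
    by (simp add: cis_conv_exp)
  moreover have "cis (- (real m * \<theta>)) * cnj (cis (- (real n * \<theta>))) = cis (d * \<theta>)" for \<theta>
    by (simp add: cis_cnj cis_mult d_def algebra_simps)
  ultimately show ?thesis
    using False by simp
qed

text \<open>Expanding the squared norm into inner products, only the diagonal survives integration.
  The negative frequencies and the shift by \<open>k\<close> are those of \<mu>^-(n+k) in the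
  resolvent series.\<close>

lemma parseval_finite:
  fixes v :: "nat \<Rightarrow> 'a::complex_inner"
  shows "((\<lambda>\<theta>. (norm (\<Sum>n<N. cis (- (real (n + k) * \<theta>)) *\<^sub>C v n))\<^sup>2) has_integral
    2 * pi * (\<Sum>n<N. (norm (v n))\<^sup>2)) {0..2 * pi}"
proof -
  let ?e = "\<lambda>n \<theta>. cis (- (real (n + k) * \<theta>))"
  have expand: "complex_of_real ((norm (\<Sum>n<N. ?e n \<theta> *\<^sub>C v n))\<^sup>2) =
      (\<Sum>n<N. \<Sum>m<N. ?e n \<theta> * cnj (?e m \<theta>) * cinner (v n) (v m))" for \<theta>
    unfolding cinner_self[symmetric] cinner_sum_left cinner_sum_right cinner_scaleC_left
      cinner_scaleC_right by (subst sum.swap) (simp only: sum_distrib_left mult.left_commute mult.assoc)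
  have "((\<lambda>\<theta>. \<Sum>n<N. \<Sum>m<N. ?e n \<theta> * cnj (?e m \<theta>) * cinner (v n) (v m)) has_integral
      (\<Sum>n<N. \<Sum>m<N. (if n + k = m + k then 2 * pi else 0) * cinner (v n) (v m))) {0..2 * pi}"
    by (intro has_integral_sum finite_lessThan has_integral_mult_left has_integral_cis_diff)
  also have "(\<Sum>n<N. \<Sum>m<N. (if n + k = m + k then 2 * pi else 0) * cinner (v n) (v m)) =
      (\<Sum>n<N. \<Sum>m<N. if n = m then 2 * pi * cinner (v n) (v m) else 0)"
    by (intro sum.cong) auto
  also have "\<dots> = complex_of_real (2 * pi * (\<Sum>n<N. (norm (v n))\<^sup>2))"
    by (simp add: cinner_self sum_distrib_left)
  finally have "((\<lambda>\<theta>. complex_of_real ((norm (\<Sum>n<N. ?e n \<theta> *\<^sub>C v n))\<^sup>2)) has_integral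
      complex_of_real (2 * pi * (\<Sum>n<N. (norm (v n))\<^sup>2))) {0..2 * pi}"
    by (simp only: expand)
  from has_integral_Re[OF this] show ?thesis
    by simp
qed

text \<open>Absolute summability bounds all partial sums by one constant, uniformly in \<theta>, so
  dominated convergence carries the finite identity to the limit.\<close>

lemma parseval:
  fixes v :: "nat \<Rightarrow> 'a::complex_inner"
  assumes "summable (\<lambda>n. norm (v n))"
    and sums: "\<And>\<theta>. (\<lambda>n. cis (- (real (n + k) * \<theta>)) *\<^sub>C v n) sums u \<theta>"
  shows "(\<lambda>n. (norm (v n))\<^sup>2) sums (integral {0..2 * pi} (\<lambda>\<theta>. (norm (u \<theta>))\<^sup>2) / (2 * pi))"
proof -
  let ?p = "\<lambda>N \<theta>. \<Sum>n<N. cis (- (real (n + k) * \<theta>)) *\<^sub>C v n"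
  define B where "B = (\<Sum>n. norm (v n))"
  have bound: "norm (?p N \<theta>) \<le> B" for N \<theta>
  proof -
    have "norm (?p N \<theta>) \<le> (\<Sum>n<N. norm (v n))"
      by (rule order_trans[OF norm_sum]) (simp add: norm_scaleC)
    also have "\<dots> \<le> B"
      unfolding B_def using assms(1) by (intro sum_le_suminf) auto
    finally show ?thesis .
  qed
  have "(\<lambda>N. integral {0..2 * pi} (\<lambda>\<theta>. (norm (?p N \<theta>))\<^sup>2)) \<longlonglongrightarrow>
      integral {0..2 * pi} (\<lambda>\<theta>. (norm (u \<theta>))\<^sup>2)"
  proof (rule dominated_convergence)
    show "(\<lambda>\<theta>. (norm (?p N \<theta>))\<^sup>2) integrable_on {0..2 * pi}" for N
      using parseval_finite by blast
    show "(\<lambda>_. B\<^sup>2) integrable_on {0..2 * pi}"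
      by (rule integrable_const_ivl)
    show "norm ((norm (?p N \<theta>))\<^sup>2) \<le> B\<^sup>2" for N \<theta>
      using power_mono[OF bound norm_ge_zero] by simp
    show "(\<lambda>N. (norm (?p N \<theta>))\<^sup>2) \<longlonglongrightarrow> (norm (u \<theta>))\<^sup>2" for \<theta>
      using sums unfolding sums_def by (intro tendsto_intros)
  qed
  then have "(\<lambda>N. 2 * pi * (\<Sum>n<N. (norm (v n))\<^sup>2)) \<longlonglongrightarrow>
      integral {0..2 * pi} (\<lambda>\<theta>. (norm (u \<theta>))\<^sup>2)"
    by (simp only: integral_unique[OF parseval_finite])
  from tendsto_divide[OF this tendsto_const[of "2 * pi"]] show ?thesis
    by (simp add: sums_def)
qed

section \<open>Powers of the resolvent\<close>

text \<open>Newton's binomial series with exponent -(j+1) at the point -x; negating the upper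
  argument of \<open>gchoose\<close> produces signs that cancel against those of the powers.\<close>

lemma negative_binomial_sums:
  fixes x :: real
  assumes "\<bar>x\<bar> < 1"
  shows "(\<lambda>n. real (n + j choose n) * x ^ n) sums (1 / (1 - x) ^ Suc j)"
proof -
  have "(\<lambda>n. (- real (Suc j) gchoose n) * (- x) ^ n) sums (1 + - x) powr (- real (Suc j))"
    using assms by (intro gen_binomial_real) simp
  moreover have "(- real (Suc j) gchoose n) * (- x) ^ n = real (n + j choose n) * x ^ n" for n
  proof -
    have "(- real (Suc j) gchoose n) = (- 1) ^ n * (real (n + j) gchoose n)"
      by (subst gbinomial_minus) (simp add: algebra_simps)
    then have "(- real (Suc j) gchoose n) * (- x) ^ n = (real (n + j) gchoose n) * ((- 1) ^ n * (- x) ^ n)"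
      by simp
    also have "(- 1) ^ n * (- x) ^ n = x ^ n"
      by (simp flip: power_mult_distrib)
    finally show ?thesis
      by (simp add: binomial_gbinomial)
  qed
  moreover have "(1 + - x) powr (- real (Suc j)) = 1 / (1 - x) ^ Suc j"
    using assms by (simp only: powr_minus, subst powr_realpow) (auto simp: divide_inverse)
  ultimately show ?thesis
    by simp
qed

lemma bounded_linear_funpow:
  "bounded_linear T \<Longrightarrow> bounded_linear (T ^^ n)"
  for T :: "'a::real_normed_vector \<Rightarrow> 'a"
  by (induction n) (auto simp: id_def o_def intro: bounded_linear_ident bounded_linear_compose)

lemma power_boundedE:
  fixes T :: "'a::complex_normed_vector \<Rightarrow> 'a"
  assumes "bounded_clinear T" "power_bounded T"
  obtains K where "K \<ge> 1" "\<And>n x. norm ((T ^^ n) x) \<le> K * norm x"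
proof -
  have bl: "bounded_linear (T ^^ n)" for n
    using assms(1) by (simp add: bounded_clinear_def bounded_linear_funpow)
  obtain K where K: "onorm (T ^^ n) \<le> K" for n
    using assms(2) by (auto simp: power_bounded_def bdd_above_def)
  show thesis
  proof (rule that[of "max 1 K"])
    show "norm ((T ^^ n) x) \<le> max 1 K * norm x" for n x
      by (rule order_trans[OF onorm[OF bl]], rule mult_right_mono) (use K[of n] in auto)
  qed simp
qed

text \<open>Since \<open>resolvent\<close> is an \<open>inv\<close>, injectivity is enough for this
  cancellation: an eigenvector for \<mu> would have an orbit growing like |\<mu>|^n, against the
  bound \<open>K\<close>. Preimages are supplied explicitly, by the series below.\<close>

lemma resolvent_cancel:
  fixes T :: "'a::complex_normed_vector \<Rightarrow> 'a"
  assumes T: "bounded_clinear T" and K: "\<And>n x. norm ((T ^^ n) x) \<le> K * norm x"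
    and \<mu>: "cmod \<mu> > 1"
  shows "resolvent \<mu> T (\<mu> *\<^sub>C z - T z) = z"
proof -
  interpret T: bounded_linear T
    using T by (simp add: bounded_clinear_def)
  interpret s: bounded_linear "\<lambda>x::'a. \<mu> *\<^sub>C x"
    by (rule bounded_linear_scaleC)
  have "x = y" if "\<mu> *\<^sub>C x - T x = \<mu> *\<^sub>C y - T y" for x y
  proof (rule ccontr)
    assume "x \<noteq> y"
    define w where "w = x - y"
    have w: "T w = \<mu> *\<^sub>C w"
      using that unfolding w_def T.diff s.diff by (simp add: algebra_simps)
    have "(T ^^ n) w = \<mu> ^ n *\<^sub>C w" for n
    proof (induction n)
      case (Suc n)
      then show ?case
        using T w by (simp add: bounded_clinear_def scaleC_scaleC mult.commute)
    qed simp
    then have "cmod \<mu> ^ n * norm w \<le> K * norm w" for n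
      using K[of n w] by (simp add: norm_scaleC norm_power)
    then have "cmod \<mu> ^ n \<le> K" for n
      using \<open>x \<noteq> y\<close> by (simp add: w_def)
    then show False
      using real_arch_pow[OF \<mu>, of K] by (meson not_less)
  qed
  then have "inj (\<lambda>x. \<mu> *\<^sub>C x - T x)"
    by (rule injI)
  then show ?thesis
    unfolding resolvent_def by (rule inv_f_f)
qed

text \<open>For \<open>k = 0\<close> truncated subtraction makes the coefficients \<open>1, 0, 0, \<dots>\<close>.\<close>

lemma resolvent_power_sums:
  fixes T :: "'a::{complex_normed_vector, complete_space} \<Rightarrow> 'a"
  assumes T: "bounded_clinear T" and K: "\<And>n x. norm ((T ^^ n) x) \<le> K * norm x"
    and \<mu>: "cmod \<mu> > 1"
  shows "summable (\<lambda>n. norm ((of_nat (n + k - 1 choose n) / \<mu> ^ (n + k)) *\<^sub>C (T ^^ n) x))"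
    and "(\<lambda>n. (of_nat (n + k - 1 choose n) / \<mu> ^ (n + k)) *\<^sub>C (T ^^ n) x) sums
      ((resolvent \<mu> T ^^ k) x)"
proof -
  interpret T: bounded_linear T
    using T by (simp add: bounded_clinear_def)
  interpret s: bounded_linear "\<lambda>x::'a. \<mu> *\<^sub>C x"
    by (rule bounded_linear_scaleC)
  define a where "a k n = (of_nat (n + k - 1 choose n) / \<mu> ^ (n + k) :: complex)" for k n
  have a0: "a 0 n = (if n = 0 then 1 else 0)" for n
    by (cases n) (auto simp: a_def)
  have summ: "summable (\<lambda>n. norm (a k n *\<^sub>C (T ^^ n) x))" for k
  proof (cases k)
    case 0
    then show ?thesis
      by (intro summable_finite[of "{0}"]) (auto simp: a0)
  next
    case (Suc j)
    \<comment> \<open>As the orbit of \<open>x\<close> is bounded, the norms are dominated by a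
      negative binomial series at 1/|\<mu>| < 1.\<close>
    have "summable (\<lambda>n. real (n + j choose n) * (1 / cmod \<mu>) ^ n)"
      using \<mu> by (intro sums_summable[OF negative_binomial_sums]) (simp add: divide_less_eq)
    then have "summable (\<lambda>n. real (n + j choose n) * (1 / cmod \<mu>) ^ n * (K * norm x / cmod \<mu> ^ k))"
      by (rule summable_mult2)
    then show ?thesis
    proof (rule summable_comparison_test'[where N = 0])
      fix n
      have "norm (a k n *\<^sub>C (T ^^ n) x) \<le> cmod (a k n) * (K * norm x)"
        by (simp add: norm_scaleC mult_left_mono K)
      also have "cmod (a k n) = real (n + j choose n) * (1 / cmod \<mu>) ^ n / cmod \<mu> ^ k"
        by (simp add: a_def Suc norm_divide norm_mult norm_power power_add field_simps)
      finally show "norm (norm (a k n *\<^sub>C (T ^^ n) x)) \<le>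
          real (n + j choose n) * (1 / cmod \<mu>) ^ n * (K * norm x / cmod \<mu> ^ k)"
        by simp
    qed
  qed
  have "(\<lambda>n. a k n *\<^sub>C (T ^^ n) x) sums ((resolvent \<mu> T ^^ k) x)"
  proof (induction k)
    case 0
    have "(\<lambda>n. a 0 n *\<^sub>C (T ^^ n) x) = (\<lambda>n. if n = 0 then x else 0)"
      by (auto simp: a0)
    then show ?case
      unfolding funpow_0 using sums_single[of 0 "\<lambda>_. x"] by (simp only:)
  next
    case (Suc k)
    \<comment> \<open>The sum \<open>z\<close> of the series for k+1 is the candidate. Applying
      \<mu> - T to it gives the series for k, and \<open>resolvent_cancel\<close> then identifies
      \<open>z\<close> as the next power.\<close>
    define z where "z = (\<Sum>n. a (Suc k) n *\<^sub>C (T ^^ n) x)"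
    have z: "(\<lambda>n. a (Suc k) n *\<^sub>C (T ^^ n) x) sums z"
      unfolding z_def by (rule summable_sums[OF summable_norm_complete[OF summ]])
    have "(\<lambda>n. a (Suc k) n *\<^sub>C (T ^^ Suc n) x) sums T z"
      using T.sums[OF z] T by (simp add: bounded_clinear_def)
    \<comment> \<open>Applying T raises the power of T by one, so the series is shifted by one
      index, with 0 in front, to be subtracted termwise.\<close>
    then have "(\<lambda>n. case n of 0 \<Rightarrow> 0 | Suc m \<Rightarrow> a (Suc k) m *\<^sub>C (T ^^ n) x) sums T z"
      using sums_Suc[of "\<lambda>n. case n of 0 \<Rightarrow> 0 | Suc m \<Rightarrow> a (Suc k) m *\<^sub>C (T ^^ n) x" "T z"]
      by (simp only: nat.case add_0_right)
    moreover have "(\<lambda>n. \<mu> *\<^sub>C a (Suc k) n *\<^sub>C (T ^^ n) x) sums (\<mu> *\<^sub>C z)"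
      by (rule s.sums[OF z])
    ultimately have "(\<lambda>n. \<mu> *\<^sub>C a (Suc k) n *\<^sub>C (T ^^ n) x -
        (case n of 0 \<Rightarrow> 0 | Suc m \<Rightarrow> a (Suc k) m *\<^sub>C (T ^^ n) x)) sums (\<mu> *\<^sub>C z - T z)"
      by (rule sums_diff[rotated])
    moreover have "\<mu> *\<^sub>C a (Suc k) n *\<^sub>C (T ^^ n) x -
        (case n of 0 \<Rightarrow> 0 | Suc m \<Rightarrow> a (Suc k) m *\<^sub>C (T ^^ n) x) = a k n *\<^sub>C (T ^^ n) x" for n
    proof (cases n)
      case 0
      then show ?thesis
        using \<mu> by (auto simp: a_def scaleC_scaleC)
    next
      case (Suc m)
      have "\<mu> \<noteq> 0"
        using \<mu> by auto
      \<comment> \<open>Pascal's rule for (m+1+k choose m+1), all three terms having denominator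
        \<mu>^(n+k).\<close>
      then have "\<mu> * a (Suc k) n - a (Suc k) m = a k n"
        by (simp add: a_def Suc field_simps)
      then show ?thesis
        by (simp add: Suc scaleC_scaleC flip: scaleC_diff_left)
    qed
    ultimately have "(\<lambda>n. a k n *\<^sub>C (T ^^ n) x) sums (\<mu> *\<^sub>C z - T z)"
      by simp
    then have "\<mu> *\<^sub>C z - T z = (resolvent \<mu> T ^^ k) x"
      using Suc.IH sums_unique2 by blast
    then have "(resolvent \<mu> T ^^ Suc k) x = z"
      using resolvent_cancel[OF T K \<mu>, of z] by simp
    then show ?case
      using z by simp
  qed
  with summ show "summable (\<lambda>n. norm ((of_nat (n + k - 1 choose n) / \<mu> ^ (n + k)) *\<^sub>C (T ^^ n) x))"
    and "(\<lambda>n. (of_nat (n + k - 1 choose n) / \<mu> ^ (n + k)) *\<^sub>C (T ^^ n) x) sums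
      ((resolvent \<mu> T ^^ k) x)"
    by (simp_all add: a_def)
qed

text \<open>On the circle of radius r, \<mu>^-(n+k) differs from r^-(n+k) by the unimodular factor
  \<open>cis (- (real (n + k) * \<theta>))\<close>, so the series is a Fourier series whose
  coefficients \<open>v n\<close> do not depend on \<theta>.\<close>

lemma resolvent_power_parseval:
  fixes T :: "'a::{complex_inner, complete_space} \<Rightarrow> 'a"
  assumes T: "bounded_clinear T" and K: "\<And>n x. norm ((T ^^ n) x) \<le> K * norm x"
    and r: "r > 1"
  shows "(\<lambda>n. (real (n + k - 1 choose n))\<^sup>2 / (r\<^sup>2) ^ (n + k) * (norm ((T ^^ n) x))\<^sup>2) sums
    (integral {0..2 * pi} (\<lambda>\<theta>. (norm ((resolvent (complex_of_real r * exp (\<i> * complex_of_real \<theta>)) T ^^ k) x))\<^sup>2)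
      / (2 * pi))"
proof -
  define v where "v n = (of_nat (n + k - 1 choose n) / complex_of_real r ^ (n + k)) *\<^sub>C (T ^^ n) x" for n
  have "(\<lambda>n. (norm (v n))\<^sup>2) sums
    (integral {0..2 * pi} (\<lambda>\<theta>. (norm ((resolvent (complex_of_real r * exp (\<i> * complex_of_real \<theta>)) T ^^ k) x))\<^sup>2)
      / (2 * pi))"
  proof (rule parseval)
    show "summable (\<lambda>n. norm (v n))"
      unfolding v_def using r by (intro resolvent_power_sums[OF T K]) auto
    fix \<theta> :: real
    let ?\<mu> = "complex_of_real r * exp (\<i> * complex_of_real \<theta>)"
    have "cmod ?\<mu> > 1"
      using r by (simp add: norm_mult)
    from resolvent_power_sums(2)[OF T K this]
    have "(\<lambda>n. (of_nat (n + k - 1 choose n) / ?\<mu> ^ (n + k)) *\<^sub>C (T ^^ n) x) sums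
        ((resolvent ?\<mu> T ^^ k) x)" .
    moreover have "(of_nat (n + k - 1 choose n) / ?\<mu> ^ (n + k)) *\<^sub>C (T ^^ n) x =
        cis (- (real (n + k) * \<theta>)) *\<^sub>C v n" for n
    proof -
      have "cis (- (real (n + k) * \<theta>)) = inverse (cis \<theta> ^ (n + k))"
        by (simp only: Complex.DeMoivre cis_inverse)
      then have "of_nat (n + k - 1 choose n) / ?\<mu> ^ (n + k) =
          cis (- (real (n + k) * \<theta>)) * (of_nat (n + k - 1 choose n) / complex_of_real r ^ (n + k))"
        by (simp only: cis_conv_exp[symmetric] power_mult_distrib) (simp add: field_simps)
      then show ?thesis
        by (simp only: v_def scaleC_scaleC)
    qed
    ultimately show "(\<lambda>n. cis (- (real (n + k) * \<theta>)) *\<^sub>C v n) sums ((resolvent ?\<mu> T ^^ k) x)"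
      by (simp only:)
  qed
  moreover have "(norm (v n))\<^sup>2 =
      (real (n + k - 1 choose n))\<^sup>2 / (r\<^sup>2) ^ (n + k) * (norm ((T ^^ n) x))\<^sup>2" for n
    using r by (simp add: v_def norm_scaleC norm_divide norm_power power_mult_distrib power_divide
        flip: power_mult)
  ultimately show ?thesis
    by simp
qed

section \<open>Bounded regularly varying functions\<close>

text \<open>The bad points, where \<open>g\<close> has no nonpositive derivative, are covered by an open set of
  small measure.  Bisection then produces finitely many disjoint intervals inside that set which
  account for the increase of \<open>g\<close> up to a term linear in the length of the interval.\<close>

lemma decreasing_if_AE_deriv_nonpos:
  fixes f g :: "real \<Rightarrow> real"
  assumes "a \<le> b" and ac: "abs_continuous_on_interval a b f" and "C \<ge> 0"
    and dom: "\<And>c d. a \<le> c \<Longrightarrow> c \<le> d \<Longrightarrow> d \<le> b \<Longrightarrow> g d - g c \<le> C * \<bar>f d - f c\<bar>"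
    and ae: "AE t in lebesgue. a \<le> t \<and> t \<le> b \<longrightarrow> (\<exists>D\<le>0. (g has_real_derivative D) (at t))"
  shows "g b \<le> g a"
proof -
  \<comment> \<open>Here \<open>e\<close> is both the excess slope allowed at good points and the
    tolerance for the variation of \<open>f\<close> over the bad intervals.\<close>
  have bound: "g b - g a \<le> e * (b - a) + C * e" if "e > 0" for e
  proof -
    obtain \<delta> where "\<delta> > 0" and \<delta>: "\<And>P. finite P \<Longrightarrow>
       (\<forall>(c, d)\<in>P. a \<le> c \<and> c < d \<and> d \<le> b) \<Longrightarrow>
       pairwise (\<lambda>(c, d) (c', d'). {c<..<d} \<inter> {c'<..<d'} = {}) P \<Longrightarrow>
       (\<Sum>(c, d)\<in>P. d - c) < \<delta> \<Longrightarrow> (\<Sum>(c, d)\<in>P. \<bar>f d - f c\<bar>) < e"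
      using ac[unfolded abs_continuous_on_interval_def, rule_format, OF \<open>e > 0\<close>] by blast
    obtain N where N: "N \<in> null_sets lebesgue"
      and bad: "{t \<in> space lebesgue. \<not> (a \<le> t \<and> t \<le> b \<longrightarrow>
        (\<exists>D\<le>0. (g has_real_derivative D) (at t)))} \<subseteq> N"
      using ae unfolding eventually_ae_filter by blast
    have good: "\<exists>D\<le>0. (g has_real_derivative D) (at t)" if "t \<notin> N" "a \<le> t" "t \<le> b" for t
      using that bad by auto
    obtain U where U: "open U" "N \<subseteq> U" "emeasure lebesgue (U - N) < ennreal \<delta>"
      using sets_lebesgue_outer_open[of N \<delta>] N \<open>\<delta> > 0\<close> by blast
    have U_small: "emeasure lebesgue U < ennreal \<delta>"
      using U N emeasure_Diff_null_set[of N lebesgue U] by auto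
    \<comment> \<open>The families to which the \<delta> of absolute continuity will be applied,
      confined to \<open>U\<close> and to [c,d].\<close>
    define fam where "fam c d Q \<longleftrightarrow> finite Q \<and>
        (\<forall>(c', d')\<in>Q. c \<le> c' \<and> c' < d' \<and> d' \<le> d \<and> {c'<..<d'} \<subseteq> U) \<and>
        pairwise (\<lambda>(c, d) (c', d'). {c<..<d} \<inter> {c'<..<d'} = {}) Q"
      for c d and Q :: "(real \<times> real) set"
    \<comment> \<open>The guard \<open>a \<le> c \<and> d \<le> b\<close> is there because the local
      condition of \<open>Bolzano\<close> also concerns intervals that leave [a,b].\<close>
    define P where "P c d \<longleftrightarrow> (a \<le> c \<and> d \<le> b \<longrightarrow>
        (\<exists>Q. fam c d Q \<and> g d - g c \<le> e * (d - c) + C * (\<Sum>(c', d')\<in>Q. \<bar>f d' - f c'\<bar>)))" for c d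
    have "P a b"
      using \<open>a \<le> b\<close>
    proof (induction rule: Bolzano)
      case (trans c m d)
      show ?case
        unfolding P_def
      proof (intro impI)
        assume "a \<le> c \<and> d \<le> b"
        then obtain Q1 Q2 where Q1: "fam c m Q1"
            "g m - g c \<le> e * (m - c) + C * (\<Sum>(c', d')\<in>Q1. \<bar>f d' - f c'\<bar>)"
          and Q2: "fam m d Q2"
            "g d - g m \<le> e * (d - m) + C * (\<Sum>(c', d')\<in>Q2. \<bar>f d' - f c'\<bar>)"
          using trans unfolding P_def by (meson order_trans)
        \<comment> \<open>The members have positive length and lie on opposite sides of
          \<open>m\<close>.\<close>
        have disj: "Q1 \<inter> Q2 = {}"
          using Q1(1) Q2(1) unfolding fam_def by fastforce
        have "pairwise (\<lambda>(c, d) (c', d'). {c<..<d} \<inter> {c'<..<d'} = {}) (Q1 \<union> Q2)"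
          unfolding pairwise_def
        proof (intro ballI impI)
          fix p q
          assume pq: "p \<in> Q1 \<union> Q2" "q \<in> Q1 \<union> Q2" "p \<noteq> q"
          obtain c1 d1 c2 d2 where [simp]: "p = (c1, d1)" "q = (c2, d2)"
            by (metis surj_pair)
          consider "p \<in> Q1" "q \<in> Q1" | "p \<in> Q2" "q \<in> Q2" | "p \<in> Q1" "q \<in> Q2" | "p \<in> Q2" "q \<in> Q1"
            using pq by blast
          then show "(case p of (c, d) \<Rightarrow> \<lambda>(c', d'). {c<..<d} \<inter> {c'<..<d'} = {}) q"
          proof cases
            case 1
            then show ?thesis
              using Q1(1) pq(3) unfolding fam_def pairwise_def by blast
          next
            case 2
            then show ?thesis
              using Q2(1) pq(3) unfolding fam_def pairwise_def by blast
          next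
            case 3
            then have "d1 \<le> m" "m \<le> c2"
              using Q1(1) Q2(1) unfolding fam_def by auto
            then show ?thesis
              by auto
          next
            case 4
            then have "d2 \<le> m" "m \<le> c1"
              using Q1(1) Q2(1) unfolding fam_def by auto
            then show ?thesis
              by auto
          qed
        qed
        moreover have "\<forall>(c', d')\<in>Q1 \<union> Q2. c \<le> c' \<and> c' < d' \<and> d' \<le> d \<and> {c'<..<d'} \<subseteq> U"
          using Q1(1) Q2(1) trans(3,4) unfolding fam_def by fastforce
        ultimately have "fam c d (Q1 \<union> Q2)"
          using Q1(1) Q2(1) unfolding fam_def by blast
        moreover have "(\<Sum>(c', d')\<in>Q1 \<union> Q2. \<bar>f d' - f c'\<bar>) =
            (\<Sum>(c', d')\<in>Q1. \<bar>f d' - f c'\<bar>) + (\<Sum>(c', d')\<in>Q2. \<bar>f d' - f c'\<bar>)"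
          using Q1(1) Q2(1) disj by (intro sum.union_disjoint) (auto simp: fam_def)
        ultimately show "\<exists>Q. fam c d Q \<and>
            g d - g c \<le> e * (d - c) + C * (\<Sum>(c', d')\<in>Q. \<bar>f d' - f c'\<bar>)"
          using Q1(2) Q2(2) by (intro exI[of _ "Q1 \<union> Q2"]) (simp add: algebra_simps)
      qed
    next
      case (local x)
      show ?case
      proof (cases "x \<in> N")
        case True
        then obtain s where "s > 0" and s: "ball x s \<subseteq> U"
          using U(1,2) open_contains_ball by blast
        \<comment> \<open>Around a bad point the interval itself lies in \<open>U\<close>; as a
          one-element family it pays for its own increase by \<open>dom\<close>. A degenerate
          interval takes the empty family, since members have positive length.\<close>
        have "P c d" if cd: "c \<le> x" "x \<le> d" "d - c < s" for c d
        proof (cases "c = d")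
          case True
          then show ?thesis
            unfolding P_def by (intro impI exI[of _ "{}"]) (auto simp: fam_def)
        next
          case False
          have "{c<..<d} \<subseteq> ball x s"
            using cd by (auto simp: dist_real_def)
          then have "fam c d {(c, d)}"
            using s False cd by (auto simp: fam_def)
          then show ?thesis
            unfolding P_def using dom[of c d] cd \<open>e > 0\<close>
            by (intro impI exI[of _ "{(c, d)}"]) (auto intro: add_increasing)
        qed
        then show ?thesis
          using \<open>s > 0\<close> by blast
      next
        case False
        then obtain D where "D \<le> 0" and "(g has_real_derivative D) (at x)"
          using good local by blast
        then obtain s where "s > 0"
          and s: "\<And>y. \<bar>y - x\<bar> < s \<Longrightarrow> \<bar>g y - g x - D * (y - x)\<bar> \<le> e * \<bar>y - x\<bar>"
          using \<open>e > 0\<close> unfolding has_field_derivative_def has_derivative_at_alt by (metis real_norm_def)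
        \<comment> \<open>Around a good point the empty family suffices: the linear part with slope
          D \<le> 0 does not increase, and the errors on the two sides of \<open>x\<close> add up to
          \<open>e * (d - c)\<close>.\<close>
        have "P c d" if cd: "c \<le> x" "x \<le> d" "d - c < s" for c d
        proof -
          have "\<bar>g d - g x - D * (d - x)\<bar> \<le> e * (d - x)" "\<bar>g c - g x - D * (c - x)\<bar> \<le> e * (x - c)"
            using s[of d] s[of c] cd by auto
          moreover have "D * (d - x) \<le> 0" "D * (c - x) \<ge> 0"
            using \<open>D \<le> 0\<close> cd by (auto simp: mult_nonpos_nonneg mult_nonpos_nonpos)
          ultimately have "g d - g c \<le> e * (d - x) + e * (x - c)"
            by linarith
          then show ?thesis
            unfolding P_def
            by (intro impI exI[of _ "{}"]) (auto simp: fam_def algebra_simps)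
        qed
        then show ?thesis
          using \<open>s > 0\<close> by blast
      qed
    qed
    then obtain Q where Q: "fam a b Q"
      and le: "g b - g a \<le> e * (b - a) + C * (\<Sum>(c', d')\<in>Q. \<bar>f d' - f c'\<bar>)"
      unfolding P_def by blast
    \<comment> \<open>The total length is the measure of a disjoint union inside \<open>U\<close>,
      hence below \<delta>.\<close>
    have "ennreal (\<Sum>(c, d)\<in>Q. d - c) = (\<Sum>p\<in>Q. emeasure lebesgue {fst p<..<snd p})"
    proof -
      have "(\<Sum>(c, d)\<in>Q. d - c) = (\<Sum>p\<in>Q. snd p - fst p)"
        by (simp add: case_prod_unfold)
      moreover have "ennreal (\<Sum>p\<in>Q. snd p - fst p) = (\<Sum>p\<in>Q. ennreal (snd p - fst p))"
        using Q by (intro sum_ennreal[symmetric]) (auto simp: fam_def)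
      moreover have "(\<Sum>p\<in>Q. ennreal (snd p - fst p)) = (\<Sum>p\<in>Q. emeasure lebesgue {fst p<..<snd p})"
        using Q by (intro sum.cong refl) (auto simp: fam_def)
      ultimately show ?thesis
        by simp
    qed
    also have "\<dots> = emeasure lebesgue (\<Union>p\<in>Q. {fst p<..<snd p})"
      using Q by (intro sum_emeasure)
        (auto simp: fam_def disjoint_family_on_def pairwise_def case_prod_unfold)
    also have "(\<Union>p\<in>Q. {fst p<..<snd p}) \<subseteq> U"
      using Q unfolding fam_def by fastforce
    then have "emeasure lebesgue (\<Union>p\<in>Q. {fst p<..<snd p}) \<le> emeasure lebesgue U"
      using U(1) by (intro emeasure_mono) auto
    also note U_small
    finally have "(\<Sum>(c, d)\<in>Q. d - c) < \<delta>"
      by (meson ennreal_leI not_less)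
    then have "(\<Sum>(c, d)\<in>Q. \<bar>f d - f c\<bar>) < e"
      using Q by (intro \<delta>) (auto simp: fam_def)
    then show ?thesis
      using le \<open>C \<ge> 0\<close> by (meson add_left_mono less_imp_le mult_left_mono order_trans)
  qed
  \<comment> \<open>The bound is linear in its parameter; dividing by \<open>b - a + C + 1\<close>,
    which is positive, brings it below \<open>e\<close>.\<close>
  have "g b - g a \<le> 0 + e" if "e > 0" for e
  proof -
    have "b - a + C + 1 > 0"
      using \<open>a \<le> b\<close> \<open>C \<ge> 0\<close> by simp
    then have "g b - g a \<le> e / (b - a + C + 1) * (b - a) + C * (e / (b - a + C + 1))"
      using that by (intro bound) simp
    also have "\<dots> = e * ((b - a + C) / (b - a + C + 1))"
      by (simp only: add_divide_distrib distrib_left) (simp add: mult.commute)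
    also have "\<dots> \<le> e * 1"
      using that \<open>b - a + C + 1 > 0\<close> by (intro mult_left_mono) (auto simp: field_simps)
    finally show ?thesis
      by simp
  qed
  then show ?thesis
    using field_le_epsilon[of "g b - g a" 0] by simp
qed

text \<open>The quotient f(t)/t^\<alpha> decreases: almost everywhere its derivative is
  t^(-\<alpha>-1) (t f' - \<alpha> f) \<le> 0.\<close>

lemma bounded_regularly_varying_growth:
  assumes f: "bounded_regularly_varying \<alpha> f" and "\<alpha> \<ge> 0"
  obtains t\<^sub>0 where "t\<^sub>0 > 0" "mono_on {t\<^sub>0..} f"
    "\<And>a b. t\<^sub>0 \<le> a \<Longrightarrow> a \<le> b \<Longrightarrow> f b \<le> f a * (b / a) powr \<alpha>"
proof -
  obtain t\<^sub>0 where t0: "t\<^sub>0 > 0" "mono_on {t\<^sub>0..} f"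
    and ac: "\<And>a b. t\<^sub>0 \<le> a \<Longrightarrow> a \<le> b \<Longrightarrow> abs_continuous_on_interval a b f"
    and ae: "AE t in lebesgue. t \<ge> t\<^sub>0 \<longrightarrow> (\<exists>f'. (f has_real_derivative f') (at t) \<and> t * f' / f t \<le> \<alpha>)"
    and pos: "\<And>t. t > 0 \<Longrightarrow> f t > 0"
    using f unfolding bounded_regularly_varying_def by blast
  have "f b \<le> f a * (b / a) powr \<alpha>" if ab: "t\<^sub>0 \<le> a" "a \<le> b" for a b
  proof -
    have "a > 0" "b > 0"
      using ab t0 by auto
    have "f b * b powr - \<alpha> \<le> f a * a powr - \<alpha>"
    proof (rule decreasing_if_AE_deriv_nonpos[where f = f and C = "a powr - \<alpha>"
          and g = "\<lambda>t. f t * t powr - \<alpha>"])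
      show "abs_continuous_on_interval a b f"
        using ac ab by blast
      \<comment> \<open>As \<open>t powr - \<alpha>\<close> decreases, an increase of the product is
        at most a^-\<alpha> times the change of \<open>f\<close>; thus the absolute continuity of
        \<open>f\<close> controls the product.\<close>
      show "f d * d powr - \<alpha> - f c * c powr - \<alpha> \<le> a powr - \<alpha> * \<bar>f d - f c\<bar>"
        if "a \<le> c" "c \<le> d" "d \<le> b" for c d
      proof -
        have "c > 0" "d > 0"
          using that \<open>a > 0\<close> by auto
        have "f d * d powr - \<alpha> \<le> f d * c powr - \<alpha>"
          using that \<open>c > 0\<close> \<open>\<alpha> \<ge> 0\<close> pos[OF \<open>d > 0\<close>] by (intro mult_left_mono powr_mono2') auto
        then have "f d * d powr - \<alpha> - f c * c powr - \<alpha> \<le> c powr - \<alpha> * (f d - f c)"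
          by (simp add: algebra_simps)
        also have "\<dots> \<le> c powr - \<alpha> * \<bar>f d - f c\<bar>"
          by (intro mult_left_mono) auto
        also have "\<dots> \<le> a powr - \<alpha> * \<bar>f d - f c\<bar>"
          using that \<open>a > 0\<close> \<open>\<alpha> \<ge> 0\<close> by (intro mult_right_mono powr_mono2') auto
        finally show ?thesis .
      qed
      show "AE t in lebesgue. a \<le> t \<and> t \<le> b \<longrightarrow>
          (\<exists>D\<le>0. ((\<lambda>t. f t * t powr - \<alpha>) has_real_derivative D) (at t))"
        using ae
      proof (rule AE_mp, intro AE_I2 impI)
        fix t
        assume ex: "t \<ge> t\<^sub>0 \<longrightarrow> (\<exists>f'. (f has_real_derivative f') (at t) \<and> t * f' / f t \<le> \<alpha>)"
          and t: "a \<le> t \<and> t \<le> b"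
        then have "t > 0"
          using \<open>a > 0\<close> by simp
        obtain f' where f': "(f has_real_derivative f') (at t)" "t * f' / f t \<le> \<alpha>"
          using ex t ab by auto
        have "((\<lambda>t. f t * t powr - \<alpha>) has_real_derivative
            (f' * t powr - \<alpha> + (- \<alpha> * t powr (- \<alpha> - 1)) * f t)) (at t)"
          using \<open>t > 0\<close> by (intro DERIV_mult f'(1) has_real_derivative_powr)
        moreover have "f' * t powr - \<alpha> + (- \<alpha> * t powr (- \<alpha> - 1)) * f t \<le> 0"
        proof -
          have "t powr - \<alpha> = t powr (- \<alpha> - 1) * t"
            using \<open>t > 0\<close> powr_add[of t "- \<alpha> - 1" 1] by simp
          then have "f' * t powr - \<alpha> + (- \<alpha> * t powr (- \<alpha> - 1)) * f t =
              t powr (- \<alpha> - 1) * (t * f' - \<alpha> * f t)"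
            by (simp add: algebra_simps)
          moreover have "t * f' \<le> \<alpha> * f t"
            using f'(2) pos[OF \<open>t > 0\<close>] by (simp add: pos_divide_le_eq)
          ultimately show ?thesis
            by (simp add: mult_nonneg_nonpos)
        qed
        ultimately show "\<exists>D\<le>0. ((\<lambda>t. f t * t powr - \<alpha>) has_real_derivative D) (at t)"
          by blast
      qed
    qed (use ab in auto)
    then show ?thesis
      using \<open>a > 0\<close> \<open>b > 0\<close> by (simp add: powr_minus powr_divide field_simps)
  qed
  with t0 that show thesis
    by blast
qed

section \<open>Binomial sums\<close>

text \<open>With the next lemma this shows that the coefficient has exact order n^j, up to constants
  depending on j only. The induction uses n+j+1 \<le> (j+1)(n+1).\<close>

lemma binomial_le_Suc_pow: "real (n + j choose n) \<le> (real n + 1) ^ j"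
proof (induction j)
  case (Suc j)
  have eq: "(n + i choose n) = (n + i choose i)" for i
    using binomial_symmetric[of n "n + i"] by simp
  have "real (Suc j) * real (n + Suc j choose n) = real (n + Suc j) * real (n + j choose n)"
    using Suc_times_binomial[of j "n + j"] unfolding eq by (metis add_Suc_right of_nat_mult)
  also have "\<dots> \<le> (real (Suc j) * (real n + 1)) * (real n + 1) ^ j"
    by (intro mult_mono Suc) (auto simp: algebra_simps)
  finally show ?case
    by simp
qed simp

lemma Suc_pow_le_binomial: "(real n + 1) ^ j \<le> real j ^ j * real (n + j choose n)"
proof (cases "j = 0")
  case False
  have "(real n + 1) ^ j \<le> real (n + j) ^ j"
    using False by (intro power_mono) auto
  also have "\<dots> = real j ^ j * (real (n + j) / real j) ^ j"
    using False by (simp add: power_divide)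
  also have "\<dots> \<le> real j ^ j * real (n + j choose j)"
    using binomial_ge_n_over_k_pow_k[of j "n + j", where 'a = real] by (intro mult_left_mono) auto
  also have "(n + j choose j) = (n + j choose n)"
    using binomial_symmetric[of n "n + j"] by simp
  finally show ?thesis .
qed simp

text \<open>The hockey-stick identity bounds the sum of the coefficients below by a multiple of
  (N+1)^(j+1). Cauchy-Schwarz passes to squares at the price of one factor N+1.\<close>

lemma Suc_pow_le_sum_binomial_squares:
  "(real N + 1) ^ (2 * j + 1) \<le> real (Suc j) ^ (2 * j + 2) * (\<Sum>n\<le>N. (real (n + j choose n))\<^sup>2)"
proof -
  have sq: "(x ^ Suc j)\<^sup>2 = x ^ (2 * j + 2)" for x :: real
    using power_even_eq[of x "Suc j"] by simp
  have "(\<Sum>n\<le>N. real (n + j choose n)) = real (N + Suc j choose N)"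
    using sum_choose_lower[of j N] by (simp add: add.commute flip: of_nat_sum)
  then have "(real N + 1) ^ Suc j \<le> real (Suc j) ^ Suc j * (\<Sum>n\<le>N. real (n + j choose n))"
    using Suc_pow_le_binomial[of N "Suc j"] by simp
  then have "((real N + 1) ^ Suc j)\<^sup>2 \<le> (real (Suc j) ^ Suc j * (\<Sum>n\<le>N. real (n + j choose n)))\<^sup>2"
    by (intro power_mono) auto
  also have "\<dots> = (real (Suc j) ^ Suc j)\<^sup>2 * (\<Sum>n\<le>N. real (n + j choose n))\<^sup>2"
    by (rule power_mult_distrib)
  also have "\<dots> \<le> (real (Suc j) ^ Suc j)\<^sup>2 * ((\<Sum>n\<le>N. (real (n + j choose n))\<^sup>2) * real (card {..N}))"
    by (intro mult_left_mono sum_squared_le_sum_of_squares) simp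
  also have "\<dots> = (real N + 1) * (real (Suc j) ^ (2 * j + 2) * (\<Sum>n\<le>N. (real (n + j choose n))\<^sup>2))"
    by (simp only: sq) simp
  also have "((real N + 1) ^ Suc j)\<^sup>2 = (real N + 1) * (real N + 1) ^ (2 * j + 1)"
    by (simp only: sq) simp
  finally show ?thesis
    by (subst (asm) mult_le_cancel_left_pos) simp_all
qed

text \<open>Comparison with an integral in telescoping form: by the mean value theorem each term is
  at most an increment of x^(\<beta>+1)/(\<beta>+1), as x^\<beta> does not increase.\<close>

lemma sum_powr_le:
  assumes "-1 < \<beta>" "\<beta> \<le> 0"
  shows "(\<Sum>n<N. (real n + 1) powr \<beta>) \<le> real N powr (\<beta> + 1) / (\<beta> + 1)"
proof (induction N)
  case (Suc N)
  have "(\<beta> + 1) * (real N + 1) powr \<beta> \<le> (real N + 1) powr (\<beta> + 1) - real N powr (\<beta> + 1)"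
  proof (cases "N = 0")
    case False
    have "\<exists>z>real N. z < real N + 1 \<and> (real N + 1) powr (\<beta> + 1) - real N powr (\<beta> + 1) =
        (real N + 1 - real N) * ((\<beta> + 1) * z powr (\<beta> + 1 - 1))"
      using False by (intro MVT2 has_real_derivative_powr) auto
    then obtain z where z: "z > real N" "z < real N + 1"
        "(real N + 1) powr (\<beta> + 1) - real N powr (\<beta> + 1) = (\<beta> + 1) * z powr \<beta>"
      by auto
    moreover have "(real N + 1) powr \<beta> \<le> z powr \<beta>"
      using z False assms by (intro powr_mono2') auto
    ultimately show ?thesis
      using assms by (simp add: mult_left_mono)
  qed (use assms in auto)
  then have "(real N + 1) powr \<beta> \<le> ((real N + 1) powr (\<beta> + 1) - real N powr (\<beta> + 1)) / (\<beta> + 1)"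
    using assms by (simp add: pos_le_divide_eq mult.commute)
  then show ?case
    using Suc by (simp add: diff_divide_distrib add.commute)
qed simp

text \<open>Split at s(n+1) = 1, with u = (s(n+1))^-\<alpha>. Above, u \<le> 1 and a negative
  binomial series remains. Below, (1+u)^2 \<le> 2 + 2u^2, and the u^2 part is a sum of (n+1)^\<beta>
  with \<beta> = 2j - 2\<alpha>; the bounds on \<alpha> say -1 < \<beta> \<le> 0.\<close>

lemma weighted_binomial_sum_le:
  assumes \<alpha>: "real j \<le> \<alpha>" "\<alpha> < real j + 1 / 2" and s: "0 < s" "s < 3"
  shows "s ^ (2 * j + 1) *
      (\<Sum>n<N. (real (n + j choose n))\<^sup>2 / (1 + s) ^ (n + j + 1) * (1 + (s * (real n + 1)) powr - \<alpha>)\<^sup>2)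
    \<le> 4 * real (2 * j) ^ (2 * j) * 4 ^ (2 * j + 1) + 2 / (2 * real j - 2 * \<alpha> + 1)"
proof -
  define \<beta> where "\<beta> = 2 * real j - 2 * \<alpha>"
  have \<beta>: "-1 < \<beta>" "\<beta> \<le> 0"
    using \<alpha> by (auto simp: \<beta>_def)
  define A where "A = {n. n < N \<and> s * (real n + 1) < 1}"
  define c where "c = real (2 * j) ^ (2 * j)"
  have "c \<ge> 0"
    by (simp add: c_def)
  have C1: "(real (n + j choose n))\<^sup>2 \<le> (real n + 1) ^ (2 * j)" for n
    using power_mono[OF binomial_le_Suc_pow[of n j], of 2] by (simp add: mult.commute flip: power_mult)
  \<comment> \<open>The square has order n^(2j), as has the coefficient (n+2j choose n), whose power
    series is known in closed form.\<close>
  have C2: "(real (n + j choose n))\<^sup>2 / (1 + s) ^ (n + j + 1) \<le> c * (real (n + 2 * j choose n) * (1 / (1 + s)) ^ n)" for n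
  proof -
    have "(real (n + j choose n))\<^sup>2 / (1 + s) ^ (n + j + 1) \<le> (real (n + j choose n))\<^sup>2 / (1 + s) ^ n"
      using s by (intro divide_left_mono power_increasing mult_pos_pos zero_less_power) auto
    also have "\<dots> \<le> (c * real (n + 2 * j choose n)) / (1 + s) ^ n"
      unfolding c_def using s
      by (intro divide_right_mono order_trans[OF C1 Suc_pow_le_binomial]) auto
    finally show ?thesis
      by (simp add: power_one_over)
  qed
  have bound: "(real (n + j choose n))\<^sup>2 / (1 + s) ^ (n + j + 1) * (1 + (s * (real n + 1)) powr - \<alpha>)\<^sup>2
      \<le> 4 * c * (real (n + 2 * j choose n) * (1 / (1 + s)) ^ n)
        + (if n \<in> A then 2 * s powr (- 2 * \<alpha>) * (real n + 1) powr \<beta> else 0)" if "n < N" for n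
  proof -
    define a where "a = (real (n + j choose n))\<^sup>2 / (1 + s) ^ (n + j + 1)"
    define u where "u = (s * (real n + 1)) powr - \<alpha>"
    have "a \<ge> 0" "u \<ge> 0"
      using s by (auto simp: a_def u_def)
    have a: "4 * a \<le> 4 * c * (real (n + 2 * j choose n) * (1 / (1 + s)) ^ n)"
      using C2[of n] by (simp add: a_def)
    have "a * (1 + u)\<^sup>2 \<le> 4 * a + (if n \<in> A then 2 * s powr (- 2 * \<alpha>) * (real n + 1) powr \<beta> else 0)"
    proof (cases "n \<in> A")
      case True
      have "a \<le> (real n + 1) ^ (2 * j) / 1"
        unfolding a_def using s C1 by (intro frac_le one_le_power) auto
      then have "a * u\<^sup>2 \<le> (real n + 1) ^ (2 * j) * u\<^sup>2"
        by (intro mult_right_mono) auto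
      also have "\<dots> = (real n + 1) powr (2 * real j) * (s powr (- 2 * \<alpha>) * (real n + 1) powr (- 2 * \<alpha>))"
        using s powr_realpow[of "real n + 1" "2 * j"]
        by (simp add: u_def powr_power powr_mult power_mult_distrib)
      also have "\<dots> = s powr (- 2 * \<alpha>) * (real n + 1) powr \<beta>"
        by (simp add: \<beta>_def powr_diff powr_minus divide_inverse)
      finally have "a * u\<^sup>2 \<le> s powr (- 2 * \<alpha>) * (real n + 1) powr \<beta>" .
      moreover have "a * (1 + u)\<^sup>2 \<le> a * (2 + 2 * u\<^sup>2)"
        using \<open>a \<ge> 0\<close> zero_le_power2[of "1 - u"]
        by (intro mult_left_mono) (auto simp: power2_eq_square algebra_simps)
      moreover have "a * (2 + 2 * u\<^sup>2) = 2 * a + 2 * (a * u\<^sup>2)"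
        by (simp add: algebra_simps)
      ultimately show ?thesis
        using True \<open>a \<ge> 0\<close> by (simp only: if_True mult.assoc)
    next
      case False
      then have "s * (real n + 1) \<ge> 1"
        using that by (auto simp: A_def)
      then have "u \<le> (s * (real n + 1)) powr 0"
        unfolding u_def using \<alpha> by (intro powr_mono) auto
      then have "u \<le> 1"
        using s by (simp split: if_splits)
      then have "(1 + u)\<^sup>2 \<le> 2\<^sup>2"
        using \<open>u \<ge> 0\<close> by (intro power_mono) auto
      then have "a * (1 + u)\<^sup>2 \<le> a * 2\<^sup>2"
        using \<open>a \<ge> 0\<close> by (rule mult_left_mono)
      then show ?thesis
        using False by simp
    qed
    with a show ?thesis
      unfolding a_def u_def by linarith
  qed
  have "(\<Sum>n<N. (real (n + j choose n))\<^sup>2 / (1 + s) ^ (n + j + 1) * (1 + (s * (real n + 1)) powr - \<alpha>)\<^sup>2)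
      \<le> 4 * c * (\<Sum>n<N. real (n + 2 * j choose n) * (1 / (1 + s)) ^ n)
        + 2 * s powr (- 2 * \<alpha>) * (\<Sum>n\<in>A. (real n + 1) powr \<beta>)"
  proof -
    have "A = {..<N} \<inter> A"
      by (auto simp: A_def)
    then have "(\<Sum>n\<in>A. 2 * s powr (- 2 * \<alpha>) * (real n + 1) powr \<beta>) =
        (\<Sum>n<N. if n \<in> A then 2 * s powr (- 2 * \<alpha>) * (real n + 1) powr \<beta> else 0)"
      using sum.inter_restrict[of "{..<N}" "\<lambda>n. 2 * s powr (- 2 * \<alpha>) * (real n + 1) powr \<beta>" A]
      by simp
    then show ?thesis
      unfolding sum_distrib_left by (simp only: sum.distrib[symmetric]) (intro sum_mono, simp only: bound lessThan_iff)
  qed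
  \<comment> \<open>At 1/(1+s) the closed form is ((1+s)/s)^(2j+1): the powers of s cancel and s < 3
    bounds the rest.\<close>
  moreover have "s ^ (2 * j + 1) * (4 * c * (\<Sum>n<N. real (n + 2 * j choose n) * (1 / (1 + s)) ^ n))
      \<le> 4 * c * 4 ^ (2 * j + 1)"
  proof -
    have q: "\<bar>1 / (1 + s)\<bar> < 1"
      using s by simp
    have "(\<Sum>n<N. real (n + 2 * j choose n) * (1 / (1 + s)) ^ n) \<le> 1 / (1 - 1 / (1 + s)) ^ Suc (2 * j)"
      using s sum_le_suminf[OF sums_summable[OF negative_binomial_sums[OF q, of "2 * j"]], of "{..<N}"]
      by (simp only: sums_unique[OF negative_binomial_sums[OF q, of "2 * j"], symmetric]) auto
    also have "1 - 1 / (1 + s) = s / (1 + s)"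
      using s by (simp add: field_simps)
    finally have "s ^ (2 * j + 1) * (\<Sum>n<N. real (n + 2 * j choose n) * (1 / (1 + s)) ^ n)
        \<le> s ^ (2 * j + 1) * (1 / (s / (1 + s)) ^ Suc (2 * j))"
      using s by (intro mult_left_mono) auto
    also have "\<dots> = (1 + s) ^ (2 * j + 1)"
      using s by (simp add: power_divide)
    also have "\<dots> \<le> 4 ^ (2 * j + 1)"
      using s by (intro power_mono) auto
    finally have "(4 * c) * (s ^ (2 * j + 1) * (\<Sum>n<N. real (n + 2 * j choose n) * (1 / (1 + s)) ^ n))
        \<le> (4 * c) * 4 ^ (2 * j + 1)"
      using \<open>c \<ge> 0\<close> by (intro mult_left_mono) auto
    then show ?thesis
      by (simp only: mult_ac)
  qed
  moreover have "s ^ (2 * j + 1) * (2 * s powr (- 2 * \<alpha>) * (\<Sum>n\<in>A. (real n + 1) powr \<beta>)) \<le> 2 / (\<beta> + 1)"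
  proof -
    \<comment> \<open>Membership in \<open>A\<close> gives n+1 \<le> 1/s, so about 1/s terms remain
      and their sum is of order s^-(\<beta>+1).\<close>
    have "A \<subseteq> {..<nat \<lfloor>1 / s\<rfloor>}"
    proof
      fix n
      assume "n \<in> A"
      then have "real (Suc n) \<le> 1 / s"
        using s by (simp add: A_def field_simps)
      then have "Suc n \<le> nat \<lfloor>1 / s\<rfloor>"
        by (meson le_nat_floor)
      then show "n \<in> {..<nat \<lfloor>1 / s\<rfloor>}"
        by simp
    qed
    then have "(\<Sum>n\<in>A. (real n + 1) powr \<beta>) \<le> (\<Sum>n<nat \<lfloor>1 / s\<rfloor>. (real n + 1) powr \<beta>)"
      by (intro sum_mono2) auto
    also have "\<dots> \<le> real (nat \<lfloor>1 / s\<rfloor>) powr (\<beta> + 1) / (\<beta> + 1)"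
      by (rule sum_powr_le[OF \<beta>])
    also have "\<dots> \<le> (1 / s) powr (\<beta> + 1) / (\<beta> + 1)"
      using s \<beta> by (intro divide_right_mono powr_mono2) auto
    also have "(1 / s) powr (\<beta> + 1) = s powr (- (\<beta> + 1))"
      unfolding powr_minus_divide using s by (subst powr_divide) auto
    finally have "(s ^ (2 * j + 1) * (2 * s powr (- 2 * \<alpha>))) * (\<Sum>n\<in>A. (real n + 1) powr \<beta>)
        \<le> (s ^ (2 * j + 1) * (2 * s powr (- 2 * \<alpha>))) * (s powr (- (\<beta> + 1)) / (\<beta> + 1))"
      using s by (intro mult_left_mono) auto
    also have "\<dots> = 2 * (s powr real (2 * j + 1) * s powr (- 2 * \<alpha>) * s powr (- (\<beta> + 1))) / (\<beta> + 1)"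
      using s by (simp only: powr_realpow) simp
    also have "s powr real (2 * j + 1) * s powr (- 2 * \<alpha>) * s powr (- (\<beta> + 1)) = 1"
    proof -
      have "real (2 * j + 1) + - 2 * \<alpha> + - (\<beta> + 1) = 0"
        by (simp add: \<beta>_def)
      then show ?thesis
        using s by (simp only: powr_add[symmetric]) simp
    qed
    finally show ?thesis
      by (simp add: mult.assoc)
  qed
  moreover have "s ^ (2 * j + 1) > 0"
    using s by simp
  ultimately show ?thesis
    unfolding \<beta>_def[symmetric] c_def[symmetric]
    by (smt (verit) mult_left_mono distrib_left)
qed

section \<open>Comparison of growth, decay and weighted sums\<close>

text \<open>For large n the ratio f(1/s)/f(n) is bounded by monotonicity when 1/s \<le> n and by the
  growth estimate when 1/s > n. The finitely many other n use the bound \<open>W\<close>. Since 1/s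
  > 1/3 may lie below \<open>t\<^sub>0\<close>, \<open>bdd\<close> covers the values of
  \<open>f\<close> there.\<close>

lemma growth_times_decay_le:
  fixes f :: "real \<Rightarrow> real" and w :: "nat \<Rightarrow> real"
  assumes pos: "\<And>t. t > 0 \<Longrightarrow> f t > 0" and "t\<^sub>0 > 0" and mono: "mono_on {t\<^sub>0..} f"
    and growth: "\<And>a b. t\<^sub>0 \<le> a \<Longrightarrow> a \<le> b \<Longrightarrow> f b \<le> f a * (b / a) powr \<alpha>" and "\<alpha> \<ge> 0"
    and bdd: "\<And>b. bdd_above (f ` {1/3<..b})"
    and w: "\<And>n. 0 \<le> w n" "\<And>n. w n \<le> W" "\<And>n. n \<ge> n\<^sub>0 \<Longrightarrow> w n \<le> c / f (real n)" and "c \<ge> 0"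
  obtains E where "E \<ge> 0"
    "\<And>s n. 0 < s \<Longrightarrow> s < 3 \<Longrightarrow> f (1 / s) * w n \<le> E * (1 + (s * (real n + 1)) powr - \<alpha>)"
proof -
  define N where "N = max n\<^sub>0 (nat \<lceil>t\<^sub>0\<rceil>) + 1"
  have N: "real N \<ge> t\<^sub>0" "N \<ge> n\<^sub>0" "N \<ge> 1"
    unfolding N_def by linarith+
  obtain B where B: "f t \<le> B" if "t \<in> {1/3<..real N}" for t
    using bdd[of "real N"] unfolding bdd_above_def by blast
  have fN: "0 < f N" "f N \<le> B" "0 < B"
    using pos[of N] B[of N] N by auto
  have "W \<ge> 0"
    using w(1,2)[of 0] by linarith
  \<comment> \<open>The first summand serves n < N, the second n \<ge> N; its bracket lists the
    three positions of 1/s relative to N and n.\<close>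
  define E where "E = W * B * N powr \<alpha> + c * (B / f N + 1 + 2 powr \<alpha>)"
  have E1: "W * B * N powr \<alpha> \<ge> 0" and E2: "c * (B / f N + 1 + 2 powr \<alpha>) \<ge> 0"
    using \<open>W \<ge> 0\<close> fN \<open>c \<ge> 0\<close> by auto
  show thesis
  proof (rule that[of E])
    show "E \<ge> 0"
      using E1 E2 by (simp add: E_def)
    fix s :: real and n :: nat
    assume s: "0 < s" "s < 3"
    define u where "u = (s * (real n + 1)) powr - \<alpha>"
    have "u \<ge> 0"
      by (simp add: u_def)
    have s3: "1 / s > 1 / 3"
      using s by (simp add: field_simps)
    show "f (1 / s) * w n \<le> E * (1 + (s * (real n + 1)) powr - \<alpha>)"
    proof (cases "n < N")
      case True
      \<comment> \<open>Up to N the bound \<open>B\<close> applies; beyond N, growth from N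
        contributes s^-\<alpha>, as N \<ge> 1.\<close>
      have "f (1 / s) \<le> B * (1 + s powr - \<alpha>)"
      proof (cases "1 / s \<le> N")
        case True
        then have "f (1 / s) \<le> B * 1"
          using B s3 by simp
        also have "\<dots> \<le> B * (1 + s powr - \<alpha>)"
          using fN by (intro mult_left_mono) auto
        finally show ?thesis .
      next
        case False
        then have "f (1 / s) \<le> f N * (1 / s / N) powr \<alpha>"
          using N by (intro growth) auto
        also have "\<dots> \<le> B * (1 / s) powr \<alpha>"
          using fN s N \<open>\<alpha> \<ge> 0\<close> by (intro mult_mono powr_mono2) (auto simp: field_simps)
        also have "(1 / s) powr \<alpha> = s powr - \<alpha>"
          using s by (simp add: powr_minus powr_divide field_simps)
        also have "B * s powr - \<alpha> \<le> B * (1 + s powr - \<alpha>)"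
          using fN by (intro mult_left_mono) auto
        finally show ?thesis .
      qed
      \<comment> \<open>Here n+1 \<le> N, so passing from s to s(n+1) costs at most
        N^\<alpha>.\<close>
      also have "1 + s powr - \<alpha> \<le> N powr \<alpha> * (1 + u)"
      proof -
        have "s powr - \<alpha> = u * (real n + 1) powr \<alpha>"
          using s by (simp add: u_def powr_mult powr_minus)
        also have "\<dots> \<le> u * N powr \<alpha>"
          using \<open>u \<ge> 0\<close> True \<open>\<alpha> \<ge> 0\<close> by (intro mult_left_mono powr_mono2) auto
        finally have "s powr - \<alpha> \<le> u * N powr \<alpha>" .
        moreover have "1 \<le> N powr \<alpha>"
          using N \<open>\<alpha> \<ge> 0\<close> by (simp add: ge_one_powr_ge_zero)
        ultimately show ?thesis
          by (simp add: algebra_simps)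
      qed
      finally have "f (1 / s) \<le> B * (N powr \<alpha> * (1 + u))"
        using fN by auto
      then have "f (1 / s) * w n \<le> B * (N powr \<alpha> * (1 + u)) * W"
        using w(1,2)[of n] fN \<open>u \<ge> 0\<close> by (intro mult_mono) auto
      also have "\<dots> = W * B * N powr \<alpha> * (1 + u)"
        by simp
      also have "\<dots> \<le> E * (1 + u)"
        unfolding E_def using E2 \<open>u \<ge> 0\<close> by (intro mult_right_mono) auto
      finally show ?thesis
        by (simp add: u_def)
    next
      case False
      then have "n > 0" "real n \<ge> t\<^sub>0" "N \<le> n"
        using N by auto
      have "f n > 0"
        using pos \<open>n > 0\<close> by simp
      have "f (1 / s) / f n \<le> (B / f N + 1 + 2 powr \<alpha>) * (1 + u)"
      proof -
        consider "1 / s \<le> N" | "N < 1 / s" "1 / s \<le> n" | "n < 1 / s"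
          by linarith
        then have "f (1 / s) / f n \<le> B / f N + 1 + 2 powr \<alpha> * u"
        proof cases
          case 1
          have "f N \<le> f n"
            using mono_onD[OF mono, of N n] N \<open>N \<le> n\<close> by auto
          then have "f (1 / s) / f n \<le> B / f N"
            using 1 B s3 fN by (intro frac_le) auto
          then show ?thesis
            using \<open>u \<ge> 0\<close> by (simp add: add_increasing2)
        next
          case 2
          then have "f (1 / s) \<le> f n"
            using mono_onD[OF mono, of "1 / s" n] N by auto
          then have "f (1 / s) / f n \<le> 1"
            using \<open>f n > 0\<close> by simp
          then show ?thesis
            using \<open>u \<ge> 0\<close> fN by (simp add: add_increasing add_increasing2)
        next
          case 3
          have "f (1 / s) \<le> f n * (1 / s / n) powr \<alpha>"
            using 3 \<open>real n \<ge> t\<^sub>0\<close> by (intro growth) auto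
          then have "f (1 / s) / f n \<le> (1 / s / n) powr \<alpha>"
            using \<open>f n > 0\<close> by (simp add: pos_divide_le_eq mult.commute)
          \<comment> \<open>The inequality 1/n \<le> 2/(n+1) replaces n by n+1 and produces the
            factor 2^\<alpha>.\<close>
          also have "\<dots> \<le> (2 * (1 / (s * (real n + 1)))) powr \<alpha>"
          proof (rule powr_mono2)
            have "1 / real n \<le> 2 / (real n + 1)"
              using \<open>n > 0\<close> by (simp add: field_simps)
            then have "1 / s * (1 / real n) \<le> 1 / s * (2 / (real n + 1))"
              using s by (intro mult_left_mono) auto
            then show "1 / s / n \<le> 2 * (1 / (s * (real n + 1)))"
              by simp
          qed (use s \<open>\<alpha> \<ge> 0\<close> in auto)
          also have "\<dots> = 2 powr \<alpha> * (1 / (s * (real n + 1))) powr \<alpha>"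
            using s by (intro powr_mult)
          also have "(1 / (s * (real n + 1))) powr \<alpha> = u"
            unfolding u_def powr_minus_divide using s by (subst powr_divide) auto
          finally show ?thesis
            using fN by (simp add: add_increasing)
        qed
        also have "\<dots> \<le> (B / f N + 1 + 2 powr \<alpha>) * (1 + u)"
          using \<open>u \<ge> 0\<close> fN by (simp add: distrib_left distrib_right)
        finally show ?thesis .
      qed
      then have "c * (f (1 / s) / f n) \<le> c * ((B / f N + 1 + 2 powr \<alpha>) * (1 + u))"
        using \<open>c \<ge> 0\<close> by (rule mult_left_mono)
      moreover have "f (1 / s) * w n \<le> f (1 / s) * (c / f n)"
        using w(3)[of n] N \<open>N \<le> n\<close> pos[of "1 / s"] s by (intro mult_left_mono) auto
      moreover have "c * ((B / f N + 1 + 2 powr \<alpha>) * (1 + u)) \<le> E * (1 + u)"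
        unfolding E_def mult.assoc[symmetric] using E1 \<open>u \<ge> 0\<close> by (intro mult_right_mono) auto
      ultimately show ?thesis
        by (simp add: u_def mult.commute)
    qed
  qed
qed

text \<open>At s = 1/N the damping (1+s)^(n+j+1) is at most exp(j+2) for n \<le> N, and
  \<open>a N \<le> K * a n\<close> makes every term comparable to the last. What remains is the sum
  of squared coefficients, of order at least N^(2j+1).\<close>

lemma binomial_weighted_sum_ge:
  fixes a :: "nat \<Rightarrow> real"
  assumes "N \<ge> 1" and a: "\<And>n. a n \<ge> 0" "\<And>n. n \<le> N \<Longrightarrow> a N \<le> K * a n"
  shows "real N ^ (2 * j + 1) * (a N)\<^sup>2 \<le> real (Suc j) ^ (2 * j + 2) * exp (real j + 2) * K\<^sup>2 *
    (\<Sum>n\<le>N. (real (n + j choose n))\<^sup>2 / (1 + 1 / real N) ^ (n + j + 1) * (a n)\<^sup>2)"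
proof -
  have "real N ^ (2 * j + 1) * (a N)\<^sup>2 \<le> (real N + 1) ^ (2 * j + 1) * (a N)\<^sup>2"
    by (intro mult_right_mono power_mono) auto
  also have "\<dots> \<le> real (Suc j) ^ (2 * j + 2) * (\<Sum>n\<le>N. (real (n + j choose n))\<^sup>2) * (a N)\<^sup>2"
    by (intro mult_right_mono Suc_pow_le_sum_binomial_squares) auto
  also have "\<dots> = real (Suc j) ^ (2 * j + 2) * (\<Sum>n\<le>N. (real (n + j choose n))\<^sup>2 * (a N)\<^sup>2)"
    by (simp only: sum_distrib_right mult.assoc)
  also have "\<dots> \<le> real (Suc j) ^ (2 * j + 2) * (\<Sum>n\<le>N. exp (real j + 2) * K\<^sup>2 *
      ((real (n + j choose n))\<^sup>2 / (1 + 1 / real N) ^ (n + j + 1) * (a n)\<^sup>2))"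
  proof (intro mult_left_mono sum_mono)
    fix n
    assume "n \<in> {..N}"
    then have "n \<le> N"
      by simp
    have "(1 + 1 / real N) ^ (n + j + 1) \<le> exp (1 / real N) ^ (n + j + 1)"
      by (intro power_mono exp_ge_add_one_self) simp
    also have "\<dots> = exp (real (n + j + 1) * (1 / real N))"
      by (rule exp_of_nat_mult[symmetric])
    also have "\<dots> \<le> exp (real j + 2)"
    proof -
      have "real (n + j + 1) \<le> real N + (real j + 1) * 1"
        using \<open>n \<le> N\<close> by simp
      also have "\<dots> \<le> real N + (real j + 1) * real N"
        using \<open>N \<ge> 1\<close> by (intro add_left_mono mult_left_mono) auto
      finally have "real (n + j + 1) / real N \<le> real j + 2"
        using \<open>N \<ge> 1\<close> by (subst pos_divide_le_eq) (auto simp: algebra_simps)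
      then show ?thesis
        by simp
    qed
    finally have "1 \<le> exp (real j + 2) / (1 + 1 / real N) ^ (n + j + 1)"
      by (subst pos_le_divide_eq) (auto simp: add_pos_nonneg)
    moreover have "(a N)\<^sup>2 \<le> (K * a n)\<^sup>2"
      using a \<open>n \<le> N\<close> by (intro power_mono) auto
    ultimately have "1 * (a N)\<^sup>2 \<le> exp (real j + 2) / (1 + 1 / real N) ^ (n + j + 1) * (K * a n)\<^sup>2"
      by (intro mult_mono) auto
    then have "(real (n + j choose n))\<^sup>2 * (1 * (a N)\<^sup>2) \<le>
        (real (n + j choose n))\<^sup>2 * (exp (real j + 2) / (1 + 1 / real N) ^ (n + j + 1) * (K * a n)\<^sup>2)"
      by (rule mult_left_mono) simp
    then show "(real (n + j choose n))\<^sup>2 * (a N)\<^sup>2 \<le> exp (real j + 2) * K\<^sup>2 *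
        ((real (n + j choose n))\<^sup>2 / (1 + 1 / real N) ^ (n + j + 1) * (a n)\<^sup>2)"
      by (simp add: power_mult_distrib mult_ac)
  qed simp
  finally show ?thesis
    by (simp only: sum_distrib_left mult.assoc)
qed

section \<open>Equivalence of decay and resolvent bounds\<close>

text \<open>As r runs through (1,2), 1/(r^2-1) runs through all numbers above 1/3. From (i) to (ii),
  \<open>f_bounded\<close> controls \<open>f\<close> on the part of this range where regular
  variation says nothing about size. The supremum is formed in \<open>ereal\<close>, where it is
  meaningful even if infinite.\<close>

theorem theorem4p2:
  fixes T :: "'x::{complex_inner, complete_space} \<Rightarrow> 'x"
    and S :: "'y::{complex_normed_vector, complete_space} \<Rightarrow> 'x"
    and \<alpha> :: real and k :: nat and f :: "real \<Rightarrow> real"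
  assumes "bounded_clinear T" and "power_bounded T"
    and "bounded_clinear S"
    and "\<alpha> > 0" and "k \<ge> 1" and "real k > \<alpha> + 1 / 2"
    and "bounded_regularly_varying \<alpha> f"
    and f_bounded: "\<And>b. bdd_above (f ` {1/3<..b})"
  shows "(\<lambda>n. onorm ((T ^^ n) \<circ> S)) \<in> O(\<lambda>n. 1 / f (real n)) \<longleftrightarrow>
    (\<exists>M>0. \<forall>y.
       (SUP r\<in>{1<..<2}. ereal (F_weight f k (r\<^sup>2 - 1) *
          integral {0..2 * pi} (\<lambda>\<theta>.
            (norm ((resolvent (complex_of_real r * exp (\<i> * complex_of_real \<theta>)) T ^^ k) (S y)))\<^sup>2)))
       \<le> ereal (M * (norm y)\<^sup>2))"
proof -
  \<comment> \<open>With k = j+1 the coefficients become (n+j choose n) and the exponent 2k-1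
    becomes 2j+1, free of truncated subtraction.\<close>
  define j where "j = k - 1"
  have k: "k = Suc j"
    using \<open>k \<ge> 1\<close> by (simp add: j_def)
  obtain K where K: "K \<ge> 1" "\<And>n x. norm ((T ^^ n) x) \<le> K * norm x"
    using power_boundedE assms(1,2) by blast
  have bl: "bounded_linear ((T ^^ n) \<circ> S)" for n
    using assms(1,3) unfolding bounded_clinear_def comp_def
    by (intro bounded_linear_compose[OF bounded_linear_funpow]) auto
  have pos: "f t > 0" if "t > 0" for t
    using assms(7) that by (simp add: bounded_regularly_varying_def)
  define I where "I r y = integral {0..2 * pi} (\<lambda>\<theta>.
      (norm ((resolvent (complex_of_real r * exp (\<i> * complex_of_real \<theta>)) T ^^ k) (S y)))\<^sup>2)" for r y
  have I: "(\<lambda>n. (real (n + j choose n))\<^sup>2 / (r\<^sup>2) ^ (n + j + 1) * (norm ((T ^^ n) (S y)))\<^sup>2) sums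
      (I r y / (2 * pi))" if "r > 1" for r y
    using resolvent_power_parseval[OF assms(1) K(2) that, of k "S y"] unfolding I_def k by simp
  have "(\<lambda>n. onorm ((T ^^ n) \<circ> S)) \<in> O(\<lambda>n. 1 / f (real n)) \<longleftrightarrow>
    (\<exists>M>0. \<forall>y. \<forall>r\<in>{1<..<2}. F_weight f k (r\<^sup>2 - 1) * I r y \<le> M * (norm y)\<^sup>2)"
    (is "?lhs \<longleftrightarrow> ?rhs")
  proof
    assume ?lhs
    then obtain c where c: "c > 0"
      and "eventually (\<lambda>n. norm (onorm ((T ^^ n) \<circ> S)) \<le> c * norm (1 / f (real n))) sequentially"
      by (elim landau_o.bigE)
    then obtain n\<^sub>0 where n0: "\<And>n. n \<ge> n\<^sub>0 \<Longrightarrow> norm (onorm ((T ^^ n) \<circ> S)) \<le> c * norm (1 / f (real n))"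
      unfolding eventually_sequentially by blast
    \<comment> \<open>\<open>Suc n\<^sub>0\<close> excludes n = 0, where \<open>f\<close> need not
      be positive.\<close>
    have decay: "onorm ((T ^^ n) \<circ> S) \<le> c / f (real n)" if "n \<ge> Suc n\<^sub>0" for n
      using n0[of n] that pos[of n] by auto
    have w_bound: "onorm ((T ^^ n) \<circ> S) \<le> K * onorm S" for n
    proof (rule onorm_bound)
      show "norm (((T ^^ n) \<circ> S) x) \<le> K * onorm S * norm x" for x
      proof -
        have "norm ((T ^^ n) (S x)) \<le> K * norm (S x)"
          by (rule K)
        also have "\<dots> \<le> K * (onorm S * norm x)"
          using K(1) assms(3) by (intro mult_left_mono onorm) (auto simp: bounded_clinear_def)
        finally show ?thesis
          by (simp add: mult.assoc)
      qed
      show "0 \<le> K * onorm S"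
        using K(1) assms(3) by (simp add: onorm_pos_le bounded_clinear_def)
    qed
    obtain t\<^sub>0 where t0: "t\<^sub>0 > 0" "mono_on {t\<^sub>0..} f"
      and growth: "\<And>a b. t\<^sub>0 \<le> a \<Longrightarrow> a \<le> b \<Longrightarrow> f b \<le> f a * (b / a) powr \<alpha>"
      using bounded_regularly_varying_growth[OF assms(7)] \<open>\<alpha> > 0\<close> by auto
    \<comment> \<open>Enlarging the exponent only weakens the growth bound; with \<open>j \<le> \<alpha>'\<close> the sum
      \<open>\<Sum>n. n powr (2 * (j - \<alpha>'))\<close> has decreasing terms.\<close>
    define \<alpha>' where "\<alpha>' = max \<alpha> (real j)"
    have \<alpha>': "real j \<le> \<alpha>'" "\<alpha>' < real j + 1 / 2" "\<alpha>' \<ge> 0"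
      using \<open>real k > \<alpha> + 1 / 2\<close> by (auto simp: \<alpha>'_def k)
    have growth': "f b \<le> f a * (b / a) powr \<alpha>'" if "t\<^sub>0 \<le> a" "a \<le> b" for a b
    proof -
      have "f b \<le> f a * (b / a) powr \<alpha>"
        by (rule growth[OF that])
      also have "\<dots> \<le> f a * (b / a) powr \<alpha>'"
        using that t0(1) pos[of a] by (intro mult_left_mono powr_mono) (auto simp: \<alpha>'_def)
      finally show ?thesis .
    qed
    obtain E where E: "E \<ge> 0" "\<And>s n. 0 < s \<Longrightarrow> s < 3 \<Longrightarrow>
        f (1 / s) * onorm ((T ^^ n) \<circ> S) \<le> E * (1 + (s * (real n + 1)) powr - \<alpha>')"
      using growth_times_decay_le[of f t\<^sub>0 \<alpha>' "\<lambda>n. onorm ((T ^^ n) \<circ> S)", OF pos t0 growth' \<alpha>'(3)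
          f_bounded onorm_pos_le[OF bl] w_bound decay] c by auto
    define D where "D = 4 * real (2 * j) ^ (2 * j) * 4 ^ (2 * j + 1) + 2 / (2 * real j - 2 * \<alpha>' + 1)"
    have "D \<ge> 0"
      using \<alpha>' by (auto simp: D_def)
    \<comment> \<open>The summand 1 keeps the constant strictly positive, as (ii) demands, even if
      \<open>E\<close> vanishes.\<close>
    have "F_weight f k (r\<^sup>2 - 1) * I r y \<le> (2 * pi * E\<^sup>2 * D + 1) * (norm y)\<^sup>2" if r: "1 < r" "r < 2" for r y
    proof -
      define s where "s = r\<^sup>2 - 1"
      have s: "0 < s" "s < 3"
        using r power_strict_mono[of 1 r 2] power_strict_mono[of r 2 2] by (auto simp: s_def)
      let ?a = "\<lambda>n. (real (n + j choose n))\<^sup>2 / (1 + s) ^ (n + j + 1)"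
      let ?x = "\<lambda>n. norm ((T ^^ n) (S y))"
      \<comment> \<open>The partial sums are bounded uniformly in N; the limit then gives the
        integral.\<close>
      have "F_weight f k s * (\<Sum>n<N. ?a n * (?x n)\<^sup>2) \<le> E\<^sup>2 * D * (norm y)\<^sup>2" for N
      proof -
        have "F_weight f k s * (\<Sum>n<N. ?a n * (?x n)\<^sup>2) =
            s ^ (2 * j + 1) * (\<Sum>n<N. ?a n * (f (1 / s) * ?x n)\<^sup>2)"
          by (simp add: F_weight_def k power_mult_distrib sum_distrib_left mult_ac)
        also have "\<dots> \<le> s ^ (2 * j + 1) *
            (\<Sum>n<N. ?a n * (E * (1 + (s * (real n + 1)) powr - \<alpha>') * norm y)\<^sup>2)"
        proof (intro mult_left_mono sum_mono power_mono)
          fix n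
          have "f (1 / s) * ?x n \<le> f (1 / s) * (onorm ((T ^^ n) \<circ> S) * norm y)"
            using onorm[OF bl, of n y] pos[of "1 / s"] s by (intro mult_left_mono) auto
          also have "\<dots> \<le> E * (1 + (s * (real n + 1)) powr - \<alpha>') * norm y"
            unfolding mult.assoc[symmetric] using E(2)[OF s, of n] by (intro mult_right_mono) auto
          finally show "f (1 / s) * ?x n \<le> E * (1 + (s * (real n + 1)) powr - \<alpha>') * norm y" .
        qed (use s pos[of "1 / s"] in auto)
        also have "\<dots> = E\<^sup>2 * (norm y)\<^sup>2 * (s ^ (2 * j + 1) *
            (\<Sum>n<N. ?a n * (1 + (s * (real n + 1)) powr - \<alpha>')\<^sup>2))"
          by (simp add: power_mult_distrib sum_distrib_left mult_ac)
        also have "\<dots> \<le> E\<^sup>2 * (norm y)\<^sup>2 * D"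
          unfolding D_def by (intro mult_left_mono weighted_binomial_sum_le \<alpha>' s) simp
        finally show ?thesis
          by (simp only: mult_ac)
      qed
      moreover have "(\<lambda>N. F_weight f k s * (\<Sum>n<N. ?a n * (?x n)\<^sup>2)) \<longlonglongrightarrow> F_weight f k s * (I r y / (2 * pi))"
        using I[OF r(1), of y] by (intro tendsto_mult tendsto_const) (simp add: sums_def s_def)
      ultimately have "F_weight f k s * (I r y / (2 * pi)) \<le> E\<^sup>2 * D * (norm y)\<^sup>2"
        by (intro LIMSEQ_le_const2) auto
      then have "F_weight f k s * I r y \<le> 2 * pi * E\<^sup>2 * D * (norm y)\<^sup>2"
        by (simp add: pos_divide_le_eq mult_ac)
      also have "\<dots> \<le> (2 * pi * E\<^sup>2 * D + 1) * (norm y)\<^sup>2"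
        by (intro mult_right_mono) auto
      finally show ?thesis
        by (simp add: s_def)
    qed
    moreover have "2 * pi * E\<^sup>2 * D + 1 > 0"
      using \<open>D \<ge> 0\<close> by (simp add: add_nonneg_pos)
    ultimately show ?rhs
      by (intro exI[of _ "2 * pi * E\<^sup>2 * D + 1"]) auto
  next
    assume ?rhs
    then obtain M where "M > 0"
      and M: "\<And>y r. 1 < r \<Longrightarrow> r < 2 \<Longrightarrow> F_weight f k (r\<^sup>2 - 1) * I r y \<le> M * (norm y)\<^sup>2"
      by auto
    define D where "D = real (Suc j) ^ (2 * j + 2) * exp (real j + 2) * K\<^sup>2"
    have "D \<ge> 0"
      by (simp add: D_def)
    \<comment> \<open>Chosen so that L^2 is the constant that bounds (f(N) |T^N S y|)^2 by a
      multiple of |y|^2 below.\<close>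
    define L where "L = sqrt (D * M / (2 * pi))"
    have "L \<ge> 0"
      using \<open>D \<ge> 0\<close> \<open>M > 0\<close> by (simp add: L_def)
    have bound: "onorm ((T ^^ N) \<circ> S) \<le> L / f (real N)" if "N \<ge> 1" for N
    proof (rule onorm_bound)
      have fN: "f (real N) > 0"
        using pos that by simp
      show "0 \<le> L / f (real N)"
        using \<open>L \<ge> 0\<close> fN by simp
      fix y
      let ?x = "\<lambda>n. norm ((T ^^ n) (S y))"
      \<comment> \<open>Now r^2 - 1 = 1/N, so that \<open>F_weight\<close> becomes N^-(2j+1)
        f(N)^2.\<close>
      define r where "r = sqrt (1 + 1 / real N)"
      have r2: "r\<^sup>2 = 1 + 1 / real N"
        by (simp add: r_def)
      have "1 / real N > 0" "1 / real N \<le> 1"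
        using that by auto
      then have "1 < 1 + 1 / real N" "1 + 1 / real N < 2\<^sup>2"
        unfolding power2_eq_square by linarith+
      then have r: "1 < r" "r < 2"
        unfolding r_def by (simp_all only: real_sqrt_gt_1_iff real_less_lsqrt)
      define P where "P = (\<Sum>n\<le>N. (real (n + j choose n))\<^sup>2 / (1 + 1 / real N) ^ (n + j + 1) * (?x n)\<^sup>2)"
      have mono: "?x N \<le> K * ?x n" if "n \<le> N" for n
      proof -
        have "(T ^^ N) (S y) = (T ^^ (N - n)) ((T ^^ n) (S y))"
          using that by (metis funpow_add comp_apply le_add_diff_inverse2)
        then show ?thesis
          using K(2) by simp
      qed
      have "P \<le> I r y / (2 * pi)"
        using sum_le_suminf[OF sums_summable[OF I[OF r(1), of y]], of "{..N}"]
          sums_unique[OF I[OF r(1), of y]] by (simp add: P_def r2)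
      moreover have "real N ^ (2 * j + 1) * (?x N)\<^sup>2 \<le> D * P"
        unfolding D_def P_def by (rule binomial_weighted_sum_ge) (use that mono in auto)
      ultimately have "real N ^ (2 * j + 1) * (?x N)\<^sup>2 \<le> D * (I r y / (2 * pi))"
        using \<open>D \<ge> 0\<close> by (meson mult_left_mono order_trans)
      \<comment> \<open>This factor cancels the power of N on the left and completes
        \<open>F_weight\<close> on the right, where \<open>M\<close> applies.\<close>
      then have "(1 / real N) ^ (2 * j + 1) * (f (real N))\<^sup>2 * (real N ^ (2 * j + 1) * (?x N)\<^sup>2) \<le>
          (1 / real N) ^ (2 * j + 1) * (f (real N))\<^sup>2 * (D * (I r y / (2 * pi)))"
        by (rule mult_left_mono) simp
      also have "\<dots> = D / (2 * pi) * (F_weight f k (r\<^sup>2 - 1) * I r y)"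
        by (simp add: F_weight_def r2 k mult_ac)
      also have "\<dots> \<le> D / (2 * pi) * (M * (norm y)\<^sup>2)"
        using \<open>D \<ge> 0\<close> by (intro mult_left_mono M r) auto
      also have "\<dots> = (L * norm y)\<^sup>2"
        using \<open>D \<ge> 0\<close> \<open>M > 0\<close> by (simp add: L_def power_mult_distrib)
      also have "(1 / real N) ^ (2 * j + 1) * (f (real N))\<^sup>2 * (real N ^ (2 * j + 1) * (?x N)\<^sup>2) =
          (1 / real N * real N) ^ (2 * j + 1) * (f (real N) * ?x N)\<^sup>2"
        by (simp only: power_mult_distrib mult_ac)
      also have "\<dots> = (f (real N) * ?x N)\<^sup>2"
        using that by simp
      finally have "f (real N) * ?x N \<le> L * norm y"
        by (rule power2_le_imp_le) (use \<open>L \<ge> 0\<close> in simp)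
      then show "norm (((T ^^ N) \<circ> S) y) \<le> L / f (real N) * norm y"
        using fN by (simp add: pos_le_divide_eq mult.commute)
    qed
    show ?lhs
    \<comment> \<open>\<open>L + 1\<close> because the constant must be positive.\<close>
    proof (rule landau_o.bigI[of "L + 1"])
      show "\<forall>\<^sub>F n in sequentially. norm (onorm ((T ^^ n) \<circ> S)) \<le> (L + 1) * norm (1 / f (real n))"
        using eventually_ge_at_top[of 1]
      proof eventually_elim
        case (elim n)
        then have "f (real n) > 0"
          using pos by simp
        then have "L / f (real n) \<le> (L + 1) * norm (1 / f (real n))"
          by (simp add: field_simps)
        then show ?case
          using bound[OF elim] onorm_pos_le[OF bl, of n] by simp
      qed
    qed (use \<open>L \<ge> 0\<close> in simp)
  qed
  then show ?thesis
    by (simp only: I_def SUP_le_iff ereal_less_eq)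
qed

end
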